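(* Let $G=\mathrm{SL}(2,\mathbb{R})$ with Haar measure, and let $f\in C_c(G)$ be a real valued function which has a unique maximum or a unique minimum at a point $x_0\in G$. Then for every $1\le p<2$, the linear span of $\{\ell_x R_y f^n\mid x,y\in G,\ n\in\mathbb{N}\}$ is dense in $L^p(G)$.
   Context: $\mathbb{N}$ is the set of positive integers and $f^n(x)=(f(x))^n$. $\ell_x$ and $R_y$ denote left translation by $x$ and right translation by $y$ of functions on $G$, respectively. $C_c(G)$ is the space of continuous compactly supported functions on $G$. *)

theory Defs
  imports "HOL-Analysis.Analysis"
begin

type_synonym mat2 = "real^2^2"

definition SL2 :: "mat2 set" where
  "SL2 = {A. det A = 1}"

definition haar_SL2 :: "mat2 measure \<Rightarrow> bool" where
  "haar_SL2 \<mu> \<longleftrightarrow>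
     space \<mu> = SL2 \<and> sets \<mu> = sets (restrict_space borel SL2) \<and>
     (\<forall>x\<in>SL2. \<forall>A\<in>sets \<mu>. emeasure \<mu> ((\<lambda>z. x ** z) ` A) = emeasure \<mu> A) \<and>
     (\<forall>K. compact K \<and> K \<subseteq> SL2 \<longrightarrow> emeasure \<mu> K < \<infinity>) \<and>
     emeasure \<mu> SL2 \<noteq> 0"

definition Cc_SL2 :: "(mat2 \<Rightarrow> 'b::real_normed_vector) set" where
  "Cc_SL2 = {f. continuous_on SL2 f \<and>
      (\<exists>K. compact K \<and> K \<subseteq> SL2 \<and> (\<forall>z\<in>SL2 - K. f z = 0))}"

definition ltrans :: "mat2 \<Rightarrow> (mat2 \<Rightarrow> 'b) \<Rightarrow> mat2 \<Rightarrow> 'b" where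
  "ltrans x h = (\<lambda>z. h (matrix_inv x ** z))"

definition rtrans :: "mat2 \<Rightarrow> (mat2 \<Rightarrow> 'b) \<Rightarrow> mat2 \<Rightarrow> 'b" where
  "rtrans y h = (\<lambda>z. h (z ** y))"

end

theory Submission
  imports Defs
begin

text \<open>
  The span contains every translate of \<open>P(f)\<close> for a polynomial \<open>P\<close> with \<open>P(0) = 0\<close>, so by Weierstrass its
  closure \<open>V\<close> contains every translate of \<open>\<phi>(f)\<close> for continuous \<open>\<phi>\<close> with \<open>\<phi>(0) = 0\<close>. Since \<open>G\<close> is not
  compact, the strict extremum has \<open>f(x\<^sub>0) \<noteq> 0\<close>; taking \<open>\<phi>\<close> concentrated near \<open>f(x\<^sub>0)\<close> gives bumps \<open>w \<ge> 0\<close> with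
  support shrinking to \<open>x\<^sub>0\<close>. Then \<open>z \<mapsto> c\<^sup>-\<^sup>1 \<integral> k(x) w(x\<^sup>-\<^sup>1 z x\<^sub>0) dx\<close> with
  \<open>c = \<integral> w(y\<^sup>-\<^sup>1 x\<^sub>0) dy\<close> is close to \<open>k \<in> C\<^sub>c(G)\<close>, and its Riemann sums lie in \<open>V\<close>. The
  constant \<open>c\<close> does not depend on \<open>z\<close> by left invariance, so unimodularity is never needed.
\<close>

section \<open>Closed subspaces of \<open>L\<^sup>p\<close>\<close>

text \<open>The factor \<open>x0\<close> on the right recentres the bump:
  \<open>w (matrix_inv x ** z ** x0)\<close> is nonzero only when
  \<open>matrix_inv x ** z ** x0\<close> is near \<open>x0\<close>, that is, when \<open>z\<close>
  is near \<open>x\<close>. Averaging against it gives k(z) - c^-1 int k(x) w(x^-1 z x0) dx = c^-1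
  int (k(z) - k(x)) w(x^-1 z x0) dx, which uniform continuity of k makes small. Two obstacles shape
  the estimates. Uniform closeness says nothing in \<open>L^p\<close> over a set of infinite
  measure, so each uniform approximation comes with one fixed set of finite measure outside which
  the error vanishes. This is also why the polynomials have no constant term. Secondly, the norm
  distance on matrices is not invariant: translation by x stretches a small ball by a factor
  proportional to the norm of x. Only x near the support of k matter, and on that bounded region the
  factor is bounded.\<close>

definition Lp_space :: "real \<Rightarrow> 'a measure \<Rightarrow> ('a \<Rightarrow> complex) set" where
  "Lp_space p M = {g. g \<in> borel_measurable M \<and> integrable M (\<lambda>z. norm (g z) powr p)}"

text \<open>The p-th power of the distance is used without a root, which defines the same closure. A
  non-integrable function has Bochner integral \<open>0\<close>, so the definition is meaningful
  only for \<open>W\<close> inside \<open>Lp_space p M\<close>.\<close>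

definition Lp_closure :: "real \<Rightarrow> 'a measure \<Rightarrow> ('a \<Rightarrow> complex) set \<Rightarrow> ('a \<Rightarrow> complex) set" where
  "Lp_closure p M W = {g \<in> Lp_space p M. \<forall>\<epsilon>>0. \<exists>h\<in>W. (\<integral>z. norm (g z - h z) powr p \<partial>M) < \<epsilon>}"

text \<open>Elements are functions, not classes. The equation \<open>Lp_closure p M V = V\<close>
  forces \<open>V\<close> to lie in \<open>Lp_space p M\<close> and to contain every measurable
  function that agrees almost everywhere with a member.\<close>

definition Lp_closed_subspace :: "real \<Rightarrow> 'a measure \<Rightarrow> ('a \<Rightarrow> complex) set \<Rightarrow> bool" where
  "Lp_closed_subspace p M V \<longleftrightarrow> Lp_closure p M V = V \<and> (\<lambda>z. 0) \<in> V \<and>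
     (\<forall>g\<in>V. \<forall>h\<in>V. (\<lambda>z. g z + h z) \<in> V) \<and> (\<forall>c. \<forall>g\<in>V. (\<lambda>z. c * g z) \<in> V)"

text \<open>Bound the sum by twice the larger norm. This quasi-triangle inequality replaces
  Minkowski; the factor \<open>2 powr p\<close> is harmless for density arguments.\<close>

lemma norm_add_powr_le:
  fixes a b :: "'a::real_normed_vector"
  assumes "0 \<le> p"
  shows "norm (a + b) powr p \<le> 2 powr p * (norm a powr p + norm b powr p)"
proof -
  have "norm (a + b) \<le> 2 * max (norm a) (norm b)"
    using norm_triangle_ineq[of a b] by linarith
  then have "norm (a + b) powr p \<le> (2 * max (norm a) (norm b)) powr p"
    by (intro powr_mono2) (use assms in auto)
  also have "\<dots> = 2 powr p * (max (norm a) (norm b)) powr p"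
    by (simp add: powr_mult)
  also have "(max (norm a) (norm b)) powr p \<le> norm a powr p + norm b powr p"
    by (simp add: max_def)
  finally show ?thesis by simp
qed

lemma Lp_space_measurable [measurable_dest]: "g \<in> Lp_space p M \<Longrightarrow> g \<in> borel_measurable M"
  by (simp add: Lp_space_def)

lemma Lp_space_integrable: "g \<in> Lp_space p M \<Longrightarrow> integrable M (\<lambda>z. norm (g z) powr p)"
  by (simp add: Lp_space_def)

lemma Lp_space_dominated:
  assumes "h \<in> Lp_space p M" "0 \<le> p" and [measurable]: "g \<in> borel_measurable M"
    and "\<And>z. z \<in> space M \<Longrightarrow> norm (g z) \<le> norm (h z)"
  shows "g \<in> Lp_space p M"
  unfolding Lp_space_def
proof (intro CollectI conjI)
  show "integrable M (\<lambda>z. norm (g z) powr p)"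
    by (rule Bochner_Integration.integrable_bound[OF Lp_space_integrable[OF assms(1)]])
       (use assms in \<open>auto intro!: AE_I2 powr_mono2\<close>)
qed fact

lemma Lp_space_cmult:
  assumes "g \<in> Lp_space p M"
  shows "(\<lambda>z. c * g z) \<in> Lp_space p M"
  using assms by (auto simp: Lp_space_def norm_mult powr_mult)

lemma Lp_space_add:
  assumes g: "g \<in> Lp_space p M" and h: "h \<in> Lp_space p M" and p: "0 \<le> p"
  shows "(\<lambda>z. g z + h z) \<in> Lp_space p M"
  unfolding Lp_space_def
proof (intro CollectI conjI)
  note [measurable] = Lp_space_measurable[OF g] Lp_space_measurable[OF h]
  show "(\<lambda>z. g z + h z) \<in> borel_measurable M" by measurable
  have "integrable M (\<lambda>z. 2 powr p * (norm (g z) powr p + norm (h z) powr p))"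
    using g h by (auto simp: Lp_space_def)
  then show "integrable M (\<lambda>z. norm (g z + h z) powr p)"
    by (rule Bochner_Integration.integrable_bound)
       (use norm_add_powr_le[OF p] in \<open>auto intro!: AE_I2\<close>)
qed

lemma Lp_space_diff:
  assumes "g \<in> Lp_space p M" "h \<in> Lp_space p M" "0 \<le> p"
  shows "(\<lambda>z. g z - h z) \<in> Lp_space p M"
  using Lp_space_add[OF assms(1) Lp_space_cmult[OF assms(2), of "-1"] assms(3)] by simp

lemma Lp_space_bounded_support:
  assumes [measurable]: "g \<in> borel_measurable M" and S: "S \<in> sets M" "emeasure M S < \<infinity>"
    and p: "0 \<le> p"
    and bd: "\<And>z. z \<in> space M \<Longrightarrow> norm (g z) \<le> B * indicator S z"
  shows "g \<in> Lp_space p M"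
  unfolding Lp_space_def
proof (intro CollectI conjI)
  have "norm (norm (g z) powr p) \<le> B powr p" if "z \<in> space M" "z \<in> S" for z
    using bd[of z] that p by (auto intro!: powr_mono2)
  moreover have "norm (g z) powr p = 0" if "z \<in> space M" "z \<notin> S" for z
    using bd[of z] that by auto
  ultimately show "integrable M (\<lambda>z. norm (g z) powr p)"
    by (intro integrableI_bounded_set[OF S(1) _ S(2)]) (auto intro!: AE_I2)
qed fact

lemma Lp_integral_add_le:
  assumes g: "g \<in> Lp_space p M" and h: "h \<in> Lp_space p M" and p: "0 \<le> p"
  shows "(\<integral>z. norm (g z + h z) powr p \<partial>M) \<le>
    2 powr p * ((\<integral>z. norm (g z) powr p \<partial>M) + (\<integral>z. norm (h z) powr p \<partial>M))"
proof -
  have "(\<integral>z. norm (g z + h z) powr p \<partial>M)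
      \<le> (\<integral>z. 2 powr p * (norm (g z) powr p + norm (h z) powr p) \<partial>M)"
    using g h Lp_space_add[OF g h p] norm_add_powr_le[OF p]
    by (intro integral_mono) (auto simp: Lp_space_def)
  also have "\<dots> = 2 powr p * ((\<integral>z. norm (g z) powr p \<partial>M) + (\<integral>z. norm (h z) powr p \<partial>M))"
    using g h by (simp add: Lp_space_def)
  finally show ?thesis .
qed

lemma Lp_closureD:
  assumes "g \<in> Lp_closure p M W" "0 < \<epsilon>"
  obtains h where "h \<in> W" "(\<integral>z. norm (g z - h z) powr p \<partial>M) < \<epsilon>"
  using assms by (auto simp: Lp_closure_def)

lemma subset_Lp_closure:
  assumes "W \<subseteq> Lp_space p M"
  shows "W \<subseteq> Lp_closure p M W"
proof
  fix g assume "g \<in> W"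
  moreover from this assms have "g \<in> Lp_space p M" by blast
  ultimately show "g \<in> Lp_closure p M W"
    unfolding Lp_closure_def by (auto intro!: bexI[of _ g])
qed

lemma Lp_closed_subspace_closure:
  assumes p: "0 \<le> p" and W: "W \<subseteq> Lp_space p M" and zero: "(\<lambda>z. 0) \<in> W"
    and add: "\<And>g h. g \<in> W \<Longrightarrow> h \<in> W \<Longrightarrow> (\<lambda>z. g z + h z) \<in> W"
    and cmult: "\<And>c g. g \<in> W \<Longrightarrow> (\<lambda>z. c * g z) \<in> W"
  shows "Lp_closed_subspace p M (Lp_closure p M W)" (is "Lp_closed_subspace p M ?V")
  unfolding Lp_closed_subspace_def
proof (intro conjI ballI allI)
  have VL: "?V \<subseteq> Lp_space p M" by (auto simp: Lp_closure_def)
  have pos: "(0::real) < 2 powr p" by simp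
  show "Lp_closure p M ?V = ?V"
  proof
    show "Lp_closure p M ?V \<subseteq> ?V"
    proof
      fix g assume g: "g \<in> Lp_closure p M ?V"
      then have gL: "g \<in> Lp_space p M" by (simp add: Lp_closure_def)
      have "\<exists>k\<in>W. (\<integral>z. norm (g z - k z) powr p \<partial>M) < \<epsilon>" if e: "\<epsilon> > 0" for \<epsilon>
      proof -
        \<comment> \<open>Two errors of size \<open>\<delta>\<close>, multiplied by the
          quasi-triangle factor \<open>2 powr p\<close>, add up to
          \<open>\<epsilon>\<close>.\<close>
        define \<delta> where "\<delta> = \<epsilon> / (2 * 2 powr p)"
        have d: "\<delta> > 0" using e by (simp add: \<delta>_def)
        obtain h where h: "h \<in> ?V" "(\<integral>z. norm (g z - h z) powr p \<partial>M) < \<delta>"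
          using Lp_closureD[OF g d] .
        obtain k where k: "k \<in> W" "(\<integral>z. norm (h z - k z) powr p \<partial>M) < \<delta>"
          using Lp_closureD[OF h(1) d] .
        have hL: "h \<in> Lp_space p M" and kL: "k \<in> Lp_space p M" using h k VL W by auto
        have "(\<integral>z. norm (g z - k z) powr p \<partial>M)
            \<le> 2 powr p * ((\<integral>z. norm (g z - h z) powr p \<partial>M) + (\<integral>z. norm (h z - k z) powr p \<partial>M))"
          using Lp_integral_add_le[OF Lp_space_diff[OF gL hL p] Lp_space_diff[OF hL kL p] p] by simp
        also have "\<dots> < 2 powr p * (\<delta> + \<delta>)"
          using h k pos by (intro mult_strict_left_mono) auto
        also have "\<dots> = \<epsilon>" using pos by (simp add: \<delta>_def)
        finally show ?thesis using k by blast
      qed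
      then show "g \<in> ?V" using gL by (simp add: Lp_closure_def)
    qed
  qed (rule subset_Lp_closure[OF VL])
  show "(\<lambda>z. 0) \<in> ?V" using subset_Lp_closure[OF W] zero by blast
next
  have pos: "(0::real) < 2 powr p" by simp
  fix g h assume g: "g \<in> ?V" and h: "h \<in> ?V"
  then have L: "g \<in> Lp_space p M" "h \<in> Lp_space p M" by (auto simp: Lp_closure_def)
  have "\<exists>k\<in>W. (\<integral>z. norm (g z + h z - k z) powr p \<partial>M) < \<epsilon>" if e: "\<epsilon> > 0" for \<epsilon>
  proof -
    define \<delta> where "\<delta> = \<epsilon> / (2 * 2 powr p)"
    have d: "\<delta> > 0" using e by (simp add: \<delta>_def)
    obtain u where u: "u \<in> W" "(\<integral>z. norm (g z - u z) powr p \<partial>M) < \<delta>"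
      using Lp_closureD[OF g d] .
    obtain v where v: "v \<in> W" "(\<integral>z. norm (h z - v z) powr p \<partial>M) < \<delta>"
      using Lp_closureD[OF h d] .
    have uv: "u \<in> Lp_space p M" "v \<in> Lp_space p M" using u v W by auto
    have "(\<integral>z. norm (g z + h z - (u z + v z)) powr p \<partial>M)
        \<le> 2 powr p * ((\<integral>z. norm (g z - u z) powr p \<partial>M) + (\<integral>z. norm (h z - v z) powr p \<partial>M))"
      using Lp_integral_add_le[OF Lp_space_diff[OF L(1) uv(1) p] Lp_space_diff[OF L(2) uv(2) p] p]
      by (simp add: algebra_simps)
    also have "\<dots> < 2 powr p * (\<delta> + \<delta>)"
      using u v pos by (intro mult_strict_left_mono) auto
    also have "\<dots> = \<epsilon>" using pos by (simp add: \<delta>_def)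
    finally show ?thesis using add[OF u(1) v(1)] by (intro bexI[of _ "\<lambda>z. u z + v z"]) auto
  qed
  then show "(\<lambda>z. g z + h z) \<in> ?V"
    using Lp_space_add[OF L p] by (simp add: Lp_closure_def)
next
  fix c g assume g: "g \<in> ?V"
  then have L: "g \<in> Lp_space p M" by (auto simp: Lp_closure_def)
  have "\<exists>k\<in>W. (\<integral>z. norm (c * g z - k z) powr p \<partial>M) < \<epsilon>" if e: "\<epsilon> > 0" for \<epsilon>
  proof -
    \<comment> \<open>The \<open>+ 1\<close> keeps the denominator positive when
      \<open>c = 0\<close>.\<close>
    define \<delta> where "\<delta> = \<epsilon> / (norm c powr p + 1)"
    have d: "\<delta> > 0" using e unfolding \<delta>_def by (intro divide_pos_pos add_nonneg_pos) auto
    obtain u where u: "u \<in> W" "(\<integral>z. norm (g z - u z) powr p \<partial>M) < \<delta>"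
      using Lp_closureD[OF g d] .
    have "(\<integral>z. norm (c * g z - c * u z) powr p \<partial>M) = norm c powr p * (\<integral>z. norm (g z - u z) powr p \<partial>M)"
      by (simp add: norm_mult powr_mult flip: right_diff_distrib)
    also have "\<dots> \<le> norm c powr p * \<delta>"
      using u by (intro mult_left_mono) auto
    also have "\<dots> < (norm c powr p + 1) * \<delta>" using d by (simp add: algebra_simps)
    also have "\<dots> = \<epsilon>" unfolding \<delta>_def
      by (metis nonzero_mult_div_cancel_left times_divide_eq_right add_nonneg_pos less_irrefl powr_ge_zero zero_less_one)
    finally show ?thesis using cmult[OF u(1), of c] by (intro bexI[of _ "\<lambda>z. c * u z"]) auto
  qed
  then show "(\<lambda>z. c * g z) \<in> ?V"
    using Lp_space_cmult[OF L] by (simp add: Lp_closure_def)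
qed

section \<open>Limits inside a closed subspace of \<open>L^p\<close>\<close>

context
  fixes p :: real and M :: "'a measure" and V :: "('a \<Rightarrow> complex) set"
  assumes p: "0 < p" and V: "Lp_closed_subspace p M V"
begin

lemma Lp_closed_subspace_subset: "V \<subseteq> Lp_space p M"
  using V by (auto simp: Lp_closed_subspace_def Lp_closure_def)

lemma Lp_closed_subspace_closedI:
  assumes "g \<in> Lp_space p M"
    and "\<And>\<epsilon>. \<epsilon> > 0 \<Longrightarrow> \<exists>h\<in>V. (\<integral>z. norm (g z - h z) powr p \<partial>M) < \<epsilon>"
  shows "g \<in> V"
proof -
  have "g \<in> Lp_closure p M V" using assms by (simp add: Lp_closure_def)
  then show ?thesis using V by (simp add: Lp_closed_subspace_def)
qed

lemma Lp_closed_subspace_sum: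
  assumes "\<And>i. i \<in> I \<Longrightarrow> g i \<in> V"
  shows "(\<lambda>z. \<Sum>i\<in>I. c i * g i z) \<in> V"
  using assms V
  by (induction I rule: infinite_finite_induct) (auto simp: Lp_closed_subspace_def)

text \<open>Dominated convergence: the limit inherits the bound by \<open>B\<close>, so the p-th
  power of the error is at most \<open>2 powr p\<close> times that of \<open>B\<close>.\<close>

lemma Lp_closed_subspace_limit:
  assumes s: "\<And>i::nat. s i \<in> V" and [measurable]: "g \<in> borel_measurable M"
    and lim: "\<And>z. z \<in> space M \<Longrightarrow> (\<lambda>i. s i z) \<longlonglongrightarrow> g z"
    and B: "B \<in> Lp_space p M"
    and bd: "\<And>i z. z \<in> space M \<Longrightarrow> norm (s i z) \<le> norm (B z)"
  shows "g \<in> V"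
proof (rule Lp_closed_subspace_closedI)
  have sL: "s i \<in> Lp_space p M" for i using s Lp_closed_subspace_subset by blast
  note [measurable] = Lp_space_measurable[OF sL] Lp_space_measurable[OF B]
  have gB: "norm (g z) \<le> norm (B z)" if "z \<in> space M" for z
    using tendsto_norm[OF lim[OF that]] bd[OF that] by (intro LIMSEQ_le_const2) auto
  show "g \<in> Lp_space p M"
    using Lp_space_dominated[OF B _ _ gB] p by auto
  have "(\<lambda>i. \<integral>z. norm (g z - s i z) powr p \<partial>M) \<longlonglongrightarrow> (\<integral>z. 0 \<partial>M)"
  proof (rule integral_dominated_convergence)
    show "integrable M (\<lambda>z. 2 powr p * (norm (B z) powr p))"
      using B by (simp add: Lp_space_def)
    show "AE z in M. (\<lambda>i. norm (g z - s i z) powr p) \<longlonglongrightarrow> 0"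
    proof (rule AE_I2)
      fix z assume "z \<in> space M"
      then have "(\<lambda>i. norm (g z - s i z)) \<longlonglongrightarrow> norm (g z - g z)"
        using lim by (intro tendsto_intros) auto
      then show "(\<lambda>i. norm (g z - s i z) powr p) \<longlonglongrightarrow> 0"
        using p by (intro tendsto_zero_powrI) auto
    qed
    show "AE z in M. norm (norm (g z - s i z) powr p) \<le> 2 powr p * (norm (B z) powr p)" for i
    proof (rule AE_I2)
      fix z assume z: "z \<in> space M"
      have "norm (g z - s i z) \<le> 2 * norm (B z)"
        using norm_triangle_ineq4[of "g z" "s i z"] gB[OF z] bd[OF z, of i] by linarith
      then have "norm (g z - s i z) powr p \<le> (2 * norm (B z)) powr p"
        using p by (intro powr_mono2) auto
      then show "norm (norm (g z - s i z) powr p) \<le> 2 powr p * (norm (B z) powr p)"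
        by (simp add: powr_mult)
    qed
  qed auto
  then have lim0: "(\<lambda>i. \<integral>z. norm (g z - s i z) powr p \<partial>M) \<longlonglongrightarrow> 0" by simp
  fix \<epsilon> :: real assume "\<epsilon> > 0"
  then have "\<forall>\<^sub>F i in sequentially. (\<integral>z. norm (g z - s i z) powr p \<partial>M) < \<epsilon>"
    using order_tendstoD(2)[OF lim0] by blast
  then show "\<exists>h\<in>V. (\<integral>z. norm (g z - h z) powr p \<partial>M) < \<epsilon>"
    using s by (meson eventually_happens trivial_limit_sequentially)
qed

text \<open>The factor \<open>indicator S z\<close> keeps the error on a set of finite measure,
  which turns uniform approximation into dominated convergence.\<close>

lemma Lp_closed_subspace_uniform_limit:
  assumes [measurable]: "g \<in> borel_measurable M" and S: "S \<in> sets M" "emeasure M S < \<infinity>"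
    and approx: "\<And>\<eta>::real. 0 < \<eta> \<Longrightarrow> \<exists>h\<in>V. \<forall>z\<in>space M. norm (g z - h z) \<le> \<eta> * indicator S z"
    and g0: "\<And>z. z \<in> space M - S \<Longrightarrow> g z = 0"
  shows "g \<in> V"
proof -
  have "\<forall>i. \<exists>h\<in>V. \<forall>z\<in>space M. norm (g z - h z) \<le> inverse (real (Suc i)) * indicator S z"
    using approx by simp
  then obtain s where s: "\<And>i. s i \<in> V"
    and sg: "\<And>i z. z \<in> space M \<Longrightarrow> norm (g z - s i z) \<le> inverse (real (Suc i)) * indicator S z"
    by metis
  have sL: "s i \<in> Lp_space p M" for i using s Lp_closed_subspace_subset by blast
  note [measurable] = Lp_space_measurable[OF sL] S(1)
  \<comment> \<open>Membership of \<open>g\<close> in \<open>L^p\<close> is not assumed: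
    \<open>g\<close> differs from the member \<open>s 0\<close> by a function bounded by
    \<open>1\<close> and vanishing off \<open>S\<close>.\<close>
  have "(\<lambda>z. g z - s 0 z) \<in> Lp_space p M"
    by (rule Lp_space_bounded_support[where B=1, OF _ S]) (use sg[of _ 0] p in auto)
  then have gL: "g \<in> Lp_space p M"
    using Lp_space_add[OF _ sL[of 0], of "\<lambda>z. g z - s 0 z"] p by simp
  have IL: "(\<lambda>z. indicator S z :: complex) \<in> Lp_space p M"
    by (rule Lp_space_bounded_support[where B=1, OF _ S]) (use p in \<open>auto simp: indicator_def\<close>)
  \<comment> \<open>Every error is at most \<open>inverse (Suc i) \<le> 1\<close> on
    \<open>S\<close> and \<open>0\<close> off \<open>S\<close>, so this single function dominates
    all \<open>s i\<close>.\<close>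
  define B where "B z = complex_of_real (norm (g z) + indicator S z)" for z
  have nL: "(\<lambda>z. complex_of_real (norm (g z))) \<in> Lp_space p M"
    using gL by (auto simp: Lp_space_def)
  have "(\<lambda>z. complex_of_real (norm (g z)) + indicator S z) \<in> Lp_space p M"
    using Lp_space_add[OF nL IL] p by simp
  moreover have "(\<lambda>z. complex_of_real (norm (g z)) + indicator S z) = B"
    by (auto simp: B_def indicator_def)
  ultimately have BL: "B \<in> Lp_space p M" by simp
  have nB: "norm (B z) = norm (g z) + indicator S z" for z
    unfolding B_def norm_of_real by (simp add: indicator_def)
  show ?thesis
  proof (rule Lp_closed_subspace_limit[where s=s, OF s _ _ BL])
    fix z assume z: "z \<in> space M"
    have "(\<lambda>i. s i z - g z) \<longlonglongrightarrow> 0"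
    proof (rule Lim_null_comparison)
      show "\<forall>\<^sub>F i in sequentially. norm (s i z - g z) \<le> inverse (real (Suc i))"
        using sg[OF z] by (intro always_eventually allI)
          (metis (no_types, lifting) inverse_nonnegative_iff_nonnegative indicator_le_1 mult_left_le norm_minus_commute
            of_nat_0_le_iff order_trans)
    qed (rule LIMSEQ_inverse_real_of_nat)
    then show "(\<lambda>i. s i z) \<longlonglongrightarrow> g z" by (simp add: LIM_zero_iff)
  next
    fix i z assume z: "z \<in> space M"
    have "norm (s i z) \<le> norm (g z) + norm (g z - s i z)"
      by (metis add.commute norm_minus_commute norm_triangle_sub)
    also have "norm (g z - s i z) \<le> 1 * indicator S z"
      using sg[OF z, of i] by (rule order_trans) (intro mult_right_mono, auto simp: inverse_le_1_iff)
    finally show "norm (s i z) \<le> norm (B z)" by (simp add: nB)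
  qed simp
qed

text \<open>Simple functions converging to \<open>g\<close> and dominated by twice its norm reduce
  everything to indicators. Their complex values are absorbed as coefficients.\<close>

lemma Lp_closed_subspace_eq_Lp:
  assumes ind: "\<And>A. A \<in> sets M \<Longrightarrow> emeasure M A < \<infinity> \<Longrightarrow> (\<lambda>z. indicator A z) \<in> V"
  shows "V = Lp_space p M"
proof
  show "Lp_space p M \<subseteq> V"
  proof
    fix g assume g: "g \<in> Lp_space p M"
    note [measurable] = Lp_space_measurable[OF g]
    obtain s where s: "\<And>i. simple_function M (s i)"
      and lim: "\<And>z. z \<in> space M \<Longrightarrow> (\<lambda>i. s i z) \<longlonglongrightarrow> g z"
      and bd: "\<And>i z. z \<in> space M \<Longrightarrow> norm (s i z) \<le> 2 * norm (g z)"
      using borel_measurable_implies_sequence_metric[of g M 0] by auto metis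
    have sV: "s i \<in> V" for i
    proof -
      note [measurable] = borel_measurable_simple_function[OF s[of i]]
      have sL: "s i \<in> Lp_space p M"
        by (rule Lp_space_dominated[OF Lp_space_cmult[OF g, of 2]])
           (use p bd in \<open>auto simp: norm_mult\<close>)
      define E where "E y = s i -` {y} \<inter> space M" for y
      have E: "E y \<in> sets M" for y unfolding E_def by measurable
      \<comment> \<open>The value \<open>0\<close> is removed because its level set may have
        infinite measure. For \<open>y \<noteq> 0\<close>, integrability of the p-th power of
        \<open>s i\<close> forces \<open>E y\<close> to have finite measure.\<close>
      have "(\<lambda>z. \<Sum>y\<in>s i ` space M - {0}. y * indicator (E y) z) \<in> V"
      proof (rule Lp_closed_subspace_sum, rule ind[OF E])
        fix y assume y: "y \<in> s i ` space M - {0}"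
        have "integrable M (\<lambda>z. indicator (E y) z *\<^sub>R norm (s i z) powr p)"
          using Lp_space_integrable[OF sL] E by (intro integrable_mult_indicator) auto
        moreover have "(\<lambda>z. indicator (E y) z *\<^sub>R norm (s i z) powr p)
            = (\<lambda>z. norm y powr p * indicator (E y) z)"
          by (auto simp: E_def indicator_def)
        ultimately have "integrable M (\<lambda>z. norm y powr p * indicator (E y) z)" by simp
        then have "integrable M (\<lambda>z. indicator (E y) z :: real)" using y by simp
        then show "emeasure M (E y) < \<infinity>"
          using E by (subst (asm) integrable_indicator_iff) (auto simp: Int_absorb2 E_def)
      qed
      moreover have "(\<Sum>y\<in>s i ` space M - {0}. y * indicator (E y) z) = s i z" if "z \<in> space M" for z
      proof -
        have "(\<Sum>y\<in>s i ` space M - {0}. y * indicator (E y) z)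
            = (\<Sum>y\<in>s i ` space M. indicator (E y) z *\<^sub>R y)"
          using simple_functionD(1)[OF s[of i]]
          by (intro sum.mono_neutral_cong_left) (auto simp: indicator_def)
        also have "\<dots> = s i z"
          unfolding E_def by (rule simple_function_indicator_representation_banach[OF s that, symmetric])
        finally show ?thesis .
      qed
      ultimately obtain t where t: "t \<in> V" "\<And>z. z \<in> space M \<Longrightarrow> t z = s i z"
        by (rule that)
      \<comment> \<open>The combination \<open>t\<close> equals \<open>s i\<close> only on
        \<open>space M\<close>; closedness of \<open>V\<close> absorbs the difference
        outside.\<close>
      show "s i \<in> V"
      proof (rule Lp_closed_subspace_closedI[OF sL])
        fix \<epsilon> :: real assume "\<epsilon> > 0"
        moreover have "(\<integral>z. norm (s i z - t z) powr p \<partial>M) = (\<integral>z. 0 \<partial>M)"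
          using t by (intro Bochner_Integration.integral_cong) auto
        ultimately show "\<exists>h\<in>V. (\<integral>z. norm (s i z - h z) powr p \<partial>M) < \<epsilon>"
          using t(1) by (intro bexI[of _ t]) auto
      qed
    qed
    show "g \<in> V"
      by (rule Lp_closed_subspace_limit[where s=s, OF sV _ lim Lp_space_cmult[OF g, of 2]])
         (use bd in \<open>auto simp: norm_mult\<close>)
  qed
qed (rule Lp_closed_subspace_subset)

end

section \<open>The group and its compactly supported functions\<close>

text \<open>The norm here is the Frobenius norm. Row i of the product combines the rows of
  \<open>B\<close> with coefficients from row i of \<open>A\<close>, so Cauchy-Schwarz applies row
  by row.\<close>

lemma norm_matrix_mult_le:
  fixes A :: "real^'n^'m" and B :: "real^'k^'n"
  shows "norm (A ** B) \<le> norm A * norm B"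
proof -
  have "norm ((A ** B) $ i) \<le> norm (A $ i) * norm B" for i
  proof -
    have "(A ** B) $ i = (\<Sum>k\<in>UNIV. A $ i $ k *\<^sub>R B $ k)"
      by (simp add: matrix_matrix_mult_def vec_eq_iff)
    also have "norm \<dots> \<le> (\<Sum>k\<in>UNIV. \<bar>norm (A $ i $ k)\<bar> * \<bar>norm (B $ k)\<bar>)"
      by (rule order_trans[OF norm_sum]) simp
    also have "\<dots> \<le> norm (A $ i) * norm B"
      unfolding norm_vec_def[of "A $ i"] norm_vec_def[of B] by (rule L2_set_mult_ineq)
    finally show ?thesis .
  qed
  then have "norm (A ** B) \<le> L2_set (\<lambda>i. norm (A $ i) * norm B) UNIV"
    unfolding norm_vec_def[of "A ** B"] by (intro L2_set_mono) auto
  also have "\<dots> = norm A * norm B"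
    unfolding norm_vec_def[of A] by (simp add: L2_set_left_distrib)
  finally show ?thesis .
qed

lemma matrix_mult_diff_distrib:
  fixes A :: "real^'n^'m" and B C :: "real^'k^'n"
  shows "A ** (B - C) = A ** B - A ** C"
  by (simp add: matrix_matrix_mult_def vec_eq_iff right_diff_distrib sum_subtractf)

lemma matrix_mult_diff_rdistrib:
  fixes A B :: "real^'n^'m" and C :: "real^'k^'n"
  shows "(A - B) ** C = A ** C - B ** C"
  by (simp add: matrix_matrix_mult_def vec_eq_iff left_diff_distrib sum_subtractf)

lemma continuous_on_matrix_mult [continuous_intros]:
  fixes f :: "'a::topological_space \<Rightarrow> real^'n^'m" and g :: "'a \<Rightarrow> real^'k^'n"
  assumes "continuous_on S f" "continuous_on S g"
  shows "continuous_on S (\<lambda>x. f x ** g x)"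
  unfolding matrix_matrix_mult_def by (intro continuous_intros assms)

section \<open>Algebra and topology of SL(2,R)\<close>

lemma closed_SL2: "closed SL2"
  unfolding SL2_def det_2 by (intro closed_Collect_eq continuous_intros)

lemma SL2_borel [measurable]: "SL2 \<in> sets borel"
  using closed_SL2 by simp

lemma SL2_mat_1: "mat 1 \<in> SL2"
  by (simp add: SL2_def)

lemma SL2_mult: "x \<in> SL2 \<Longrightarrow> y \<in> SL2 \<Longrightarrow> x ** y \<in> SL2"
  by (simp add: SL2_def det_mul)

text \<open>Cayley--Hamilton: \<open>x\<^sup>2 - trace x \<cdot> x + 1 = 0\<close> when \<open>det x = 1\<close>.\<close>

lemma SL2_adjugate:
  assumes "x \<in> SL2"
  shows "x ** (trace x *\<^sub>R mat 1 - x) = mat 1" "(trace x *\<^sub>R mat 1 - x) ** x = mat 1"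
  using assms
  by (simp_all add: SL2_def det_2 trace_def vec_eq_iff forall_2 matrix_matrix_mult_def sum_2 mat_def
      algebra_simps)

text \<open>\<open>matrix_inv\<close> is defined by choice; \<open>SL2_adjugate\<close> supplies a
  witness. The explicit formula is what makes inversion continuous on the group.\<close>

lemma SL2_matrix_inv:
  assumes "x \<in> SL2"
  shows "matrix_inv x = trace x *\<^sub>R mat 1 - x"
    and SL2_inv_right: "x ** matrix_inv x = mat 1"
    and SL2_inv_left: "matrix_inv x ** x = mat 1"
    and SL2_inv: "matrix_inv x \<in> SL2"
proof -
  show r: "x ** matrix_inv x = mat 1" and l: "matrix_inv x ** x = mat 1"
    using someI[of "\<lambda>B. x ** B = mat 1 \<and> B ** x = mat 1"] SL2_adjugate[OF assms]
    unfolding matrix_inv_def by blast+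
  show "matrix_inv x = trace x *\<^sub>R mat 1 - x"
    by (metis SL2_adjugate(1)[OF assms] l matrix_mul_assoc matrix_mul_lid matrix_mul_rid)
  show "matrix_inv x \<in> SL2"
    using arg_cong[OF r, of det] assms by (simp add: SL2_def det_mul)
qed

lemma SL2_inv_cancel:
  assumes "x \<in> SL2"
  shows "x ** (matrix_inv x ** z) = z" "matrix_inv x ** (x ** z) = z"
    "z ** x ** matrix_inv x = z" "z ** matrix_inv x ** x = z"
  by (simp_all add: assms matrix_mul_assoc SL2_inv_left SL2_inv_right)
     (simp_all add: assms SL2_inv_left SL2_inv_right flip: matrix_mul_assoc)

lemma SL2_inv_unique:
  assumes "x \<in> SL2" "x ** y = mat 1"
  shows "matrix_inv x = y"
  using SL2_inv_cancel(2)[OF assms(1), of y] assms(2) by simp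

lemma SL2_inv_inv: "x \<in> SL2 \<Longrightarrow> matrix_inv (matrix_inv x) = x"
  by (intro SL2_inv_unique SL2_inv SL2_inv_left)

lemma SL2_inv_mult:
  assumes "x \<in> SL2" "y \<in> SL2"
  shows "matrix_inv (x ** y) = matrix_inv y ** matrix_inv x"
  using assms by (intro SL2_inv_unique SL2_mult) (simp_all add: SL2_inv_cancel SL2_inv_right matrix_mul_assoc)

lemma continuous_on_matrix_inv [continuous_intros]:
  assumes "continuous_on S f" "f ` S \<subseteq> SL2"
  shows "continuous_on S (\<lambda>x. matrix_inv (f x))"
proof -
  have "continuous_on S (\<lambda>x. trace (f x) *\<^sub>R mat 1 - f x)"
    unfolding trace_def by (intro continuous_intros assms)
  then show ?thesis
    by (rule continuous_on_eq) (use assms in \<open>auto simp: SL2_matrix_inv(1)\<close>)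
qed

text \<open>Shears with a large off-diagonal entry have large norm. This is the form in which
  non-compactness of the group is used.\<close>

lemma SL2_unbounded: "\<not> bounded SL2"
proof
  assume "bounded SL2"
  then obtain B where B: "\<And>z. z \<in> SL2 \<Longrightarrow> norm z \<le> B" by (auto simp: bounded_iff)
  define z :: mat2 where "z = (\<chi> i j. if i = j then 1 else if i = 1 then \<bar>B\<bar> + 1 else 0)"
  have "z \<in> SL2" by (simp add: SL2_def det_2 z_def)
  moreover have "\<bar>z $ 1 $ 2\<bar> \<le> norm z"
    using component_le_norm_cart[of "z $ 1" 2] Finite_Cartesian_Product.norm_nth_le[of z 1] by linarith
  ultimately show False using B[of z] by (simp add: z_def)
qed

lemma Cc_SL2_compose:
  assumes h: "h \<in> Cc_SL2" and \<phi>: "continuous_on SL2 \<phi>" "\<phi> ` SL2 \<subseteq> SL2"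
    and \<psi>: "continuous_on SL2 \<psi>" "\<psi> ` SL2 \<subseteq> SL2" and inv: "\<And>z. z \<in> SL2 \<Longrightarrow> \<psi> (\<phi> z) = z"
  shows "(\<lambda>z. h (\<phi> z)) \<in> Cc_SL2"
proof -
  obtain K where h': "continuous_on SL2 h" and K: "compact K" "K \<subseteq> SL2" "\<And>z. z \<in> SL2 - K \<Longrightarrow> h z = 0"
    using h by (auto simp: Cc_SL2_def)
  have "continuous_on SL2 (\<lambda>z. h (\<phi> z))"
    by (rule continuous_on_compose2[OF h' \<phi>])
  moreover have "compact (\<psi> ` K)"
    using continuous_on_subset[OF \<psi>(1) K(2)] K(1) by (rule compact_continuous_image)
  moreover have "\<psi> ` K \<subseteq> SL2" using K \<psi> by auto
  moreover have "h (\<phi> z) = 0" if "z \<in> SL2 - \<psi> ` K" for z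
    using that K(3)[of "\<phi> z"] \<phi>(2) inv[of z] by (metis Diff_iff imageI image_subset_iff)
  ultimately show ?thesis by (auto simp: Cc_SL2_def)
qed

lemma Cc_SL2_translate:
  assumes "h \<in> Cc_SL2" "x \<in> SL2" "y \<in> SL2"
  shows "(\<lambda>z. h (matrix_inv x ** z ** y)) \<in> Cc_SL2"
  by (rule Cc_SL2_compose[where \<psi>="\<lambda>z. x ** z ** matrix_inv y", OF assms(1)])
     (use assms in \<open>auto intro!: continuous_intros SL2_mult SL2_inv
        simp: matrix_mul_assoc SL2_inv_right SL2_inv_cancel\<close>)

text \<open>Substituting through \<open>z \<mapsto> x ** matrix_inv z\<close> undoes the map. This
  gives compact support of the averaging kernel in its integration variable.\<close>

lemma Cc_SL2_inverse_translate:
  assumes "h \<in> Cc_SL2" "x \<in> SL2"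
  shows "(\<lambda>y. h (matrix_inv y ** x)) \<in> Cc_SL2"
  by (rule Cc_SL2_compose[where \<psi>="\<lambda>z. x ** matrix_inv z", OF assms(1)])
     (use assms in \<open>auto intro!: continuous_intros SL2_mult SL2_inv
        simp: SL2_inv_mult SL2_inv_inv SL2_inv SL2_inv_cancel\<close>)

lemma Cc_SL2_bounded:
  assumes "h \<in> Cc_SL2"
  obtains B where "0 < B" "\<And>z. z \<in> SL2 \<Longrightarrow> norm (h z) \<le> B"
proof -
  obtain K where h: "continuous_on SL2 h" and K: "compact K" "K \<subseteq> SL2" "\<And>z. z \<in> SL2 - K \<Longrightarrow> h z = 0"
    using assms by (auto simp: Cc_SL2_def)
  have "bounded (h ` K)"
    using compact_continuous_image[OF continuous_on_subset[OF h K(2)] K(1)] by (rule compact_imp_bounded)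
  then obtain B where B: "0 < B" "\<And>z. z \<in> K \<Longrightarrow> norm (h z) \<le> B"
    by (auto simp: bounded_pos)
  then have "norm (h z) \<le> B" if "z \<in> SL2" for z
    using K(3)[of z] that by (cases "z \<in> K") auto
  with B show ?thesis using that by blast
qed

lemma Cc_SL2_map:
  assumes "h \<in> Cc_SL2" "continuous_on UNIV \<phi>" "\<phi> 0 = 0"
  shows "(\<lambda>z. \<phi> (h z)) \<in> Cc_SL2"
  using assms continuous_on_compose2[OF assms(2), of SL2 h] by (auto simp: Cc_SL2_def)

lemma Cc_SL2_of_real: "h \<in> Cc_SL2 \<Longrightarrow> (\<lambda>z. complex_of_real (h z)) \<in> Cc_SL2"
  by (rule Cc_SL2_map) (auto intro!: continuous_intros)

section \<open>Uniform Riemann sums\<close>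

text \<open>The nodes \<open>X\<close> and weights \<open>m\<close> are chosen independently of
  \<open>z\<close>, so the sum is one fixed linear combination of the functions \<open>H x\<close>.
  Uniform continuity on the compact product gives a mesh valid for all \<open>z\<close> at once.
  Measurability of the identity lets \<open>M\<close> be a Borel measure living on a subset.\<close>

lemma uniform_Riemann_sum:
  fixes H :: "'a::metric_space \<Rightarrow> 'b::metric_space \<Rightarrow> real"
  assumes meas: "(\<lambda>x. x) \<in> measurable M borel" and T: "compact T" "T \<subseteq> space M" "emeasure M T < \<infinity>"
    and S: "compact S" and H: "continuous_on (T \<times> S) (\<lambda>(x, z). H x z)" and e: "0 < e"
  obtains X m where "finite X" "X \<subseteq> T"
    "\<And>z. z \<in> S \<Longrightarrow> \<bar>(\<integral>x. indicator T x * H x z \<partial>M) - (\<Sum>x\<in>X. m x * H x z)\<bar> \<le> e"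
proof -
  \<comment> \<open>The \<open>+ 1\<close> covers the case of a null set \<open>T\<close>.\<close>
  define e' where "e' = e / (measure M T + 1)"
  have e': "0 < e'" using e unfolding e'_def by (intro divide_pos_pos add_nonneg_pos) auto
  have sets: "A \<inter> T \<in> sets M" if "A \<in> sets borel" for A
  proof -
    have "(\<lambda>x. x) -` (A \<inter> T) \<inter> space M \<in> sets M"
      using that T(1) by (intro measurable_sets[OF meas]) (auto simp: borel_compact)
    moreover have "(\<lambda>x. x) -` (A \<inter> T) \<inter> space M = A \<inter> T" using T(2) by auto
    ultimately show ?thesis by simp
  qed
  have TM: "T \<in> sets M" using sets[of UNIV] by simp
  have "uniformly_continuous_on (T \<times> S) (\<lambda>(x, z). H x z)"
    using H T(1) S by (intro compact_uniformly_continuous compact_Times)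
  then obtain \<rho> where \<rho>: "0 < \<rho>" and unif: "\<And>u v. u \<in> T \<times> S \<Longrightarrow> v \<in> T \<times> S \<Longrightarrow> dist v u < \<rho> \<Longrightarrow>
      dist ((\<lambda>(x, z). H x z) v) ((\<lambda>(x, z). H x z) u) < e'"
    using e' unfolding uniformly_continuous_on_def by metis
  obtain X where X: "X \<subseteq> T" "finite X" "T \<subseteq> (\<Union>x\<in>X. ball x \<rho>)"
  proof (rule compactE_image[OF T(1), of T "\<lambda>x. ball x \<rho>"])
    show "T \<subseteq> (\<Union>x\<in>T. ball x \<rho>)" using \<rho> by auto
  qed (auto simp: that)
  obtain r :: "'a \<Rightarrow> nat" where r: "inj_on r X"
    using finite_imp_inj_to_nat_seg[OF X(2)] by blast
  \<comment> \<open>Disjoint cells: the injective numbering \<open>r\<close> assigns each point of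
    \<open>T\<close> to the first ball containing it. The weight of a node will be the measure of
    its cell.\<close>
  define E where "E x = (ball x \<rho> - (\<Union>y\<in>{y\<in>X. r y < r x}. ball y \<rho>)) \<inter> T" for x
  have EM: "E x \<in> sets M" for x
    unfolding E_def using X(2) by (intro sets sets.Diff sets.finite_UN) auto
  have EfM: "emeasure M (E x) < \<infinity>" for x
    using emeasure_mono[OF _ TM, of "E x"] T(3) by (auto simp: E_def)
  have disj: "x = y" if "z \<in> E x" "z \<in> E y" "x \<in> X" "y \<in> X" for x y z
    using that r by (auto simp: E_def inj_on_def) (metis linorder_less_linear)
  have cover: "\<exists>x\<in>X. z \<in> E x" if z: "z \<in> T" for z
  proof -
    obtain x0 where "x0 \<in> X \<and> z \<in> ball x0 \<rho>" using X(3) z by auto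
    then obtain x where x: "x \<in> X \<and> z \<in> ball x \<rho>" "\<And>y. y \<in> X \<and> z \<in> ball y \<rho> \<Longrightarrow> r x \<le> r y"
      using ex_has_least_nat[of "\<lambda>x. x \<in> X \<and> z \<in> ball x \<rho>" x0 r] by blast
    then have "z \<in> E x" using z by (fastforce simp: E_def)
    then show ?thesis using x by blast
  qed
  have bound: "\<bar>(\<integral>x. indicator T x * H x z \<partial>M) - (\<Sum>y\<in>X. measure M (E y) * H y z)\<bar> \<le> e" if z: "z \<in> S" for z
  proof -
    have "continuous_on T (\<lambda>x. (x, z))" by (intro continuous_intros)
    then have "continuous_on T (\<lambda>x. H x z)"
      using continuous_on_compose2[OF H, of T "\<lambda>x. (x, z)"] z by auto
    then have "(\<lambda>x. indicator T x *\<^sub>R H x z) \<in> borel_measurable borel"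
      using T(1) by (intro borel_measurable_continuous_on_indicator) (auto simp: borel_compact)
    from measurable_compose[OF meas this]
    have HM: "(\<lambda>x. indicator T x * H x z) \<in> borel_measurable M" by simp
    have pt: "\<bar>indicator T x * H x z - (\<Sum>y\<in>X. indicator (E y) x * H y z)\<bar> \<le> e' * indicator T x" for x
    proof (cases "x \<in> T")
      case True
      then obtain y where y: "y \<in> X" "x \<in> E y" using cover by blast
      have "(\<Sum>y'\<in>X. indicator (E y') x * H y' z) = (\<Sum>y'\<in>{y}. indicator (E y') x * H y' z)"
        using y disj X(2) by (intro sum.mono_neutral_right) (auto simp: indicator_def)
      moreover have "dist (H y z) (H x z) < e'"
        using unif[of "(x, z)" "(y, z)"] y X(1) z True by (auto simp: E_def dist_Pair_Pair)
      ultimately show ?thesis using y True by (simp add: dist_real_def abs_minus_commute)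
    next
      case False
      then show ?thesis by (simp add: E_def)
    qed
    have int2: "integrable M (\<lambda>x. \<Sum>y\<in>X. indicator (E y) x * H y z)"
      using EM EfM by (intro Bochner_Integration.integrable_sum integrable_mult_left) auto
    have intT: "integrable M (\<lambda>x. e' * indicator T x)"
      using TM T(3) by auto
    have "integrable M (\<lambda>x. indicator T x * H x z - (\<Sum>y\<in>X. indicator (E y) x * H y z))"
      by (rule Bochner_Integration.integrable_bound[OF intT]) (use HM int2 order_trans[OF pt abs_ge_self] in auto)
    from Bochner_Integration.integrable_add[OF this int2]
    have int3: "integrable M (\<lambda>x. indicator T x * H x z)" by simp
    have "(\<integral>x. (\<Sum>y\<in>X. indicator (E y) x * H y z) \<partial>M) = (\<Sum>y\<in>X. measure M (E y) * H y z)"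
      using EM EfM sets.sets_into_space[OF EM]
      by (subst Bochner_Integration.integral_sum) (auto simp: Int_absorb2)
    then have "\<bar>(\<integral>x. indicator T x * H x z \<partial>M) - (\<Sum>y\<in>X. measure M (E y) * H y z)\<bar>
        = \<bar>\<integral>x. indicator T x * H x z - (\<Sum>y\<in>X. indicator (E y) x * H y z) \<partial>M\<bar>"
      using int2 int3 by simp
    also have "\<dots> \<le> (\<integral>x. e' * indicator T x \<partial>M)"
      using int2 int3 intT pt by (intro integral_abs_bound[THEN order_trans] integral_mono) auto
    also have "\<dots> = e' * measure M T"
      using T(2) by (simp add: Int_absorb2)
    also have "\<dots> \<le> e' * (measure M T + 1)" using e' by (simp add: algebra_simps)
    also have "\<dots> = e"
      unfolding e'_def by (metis nonzero_mult_div_cancel_right times_divide_eq_left add_nonneg_pos less_irrefl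
        measure_nonneg zero_less_one)
    finally show ?thesis .
  qed
  show ?thesis using that[OF X(2,1) bound] by blast
qed

section \<open>Haar measure and approximation of continuous functions\<close>

context
  fixes \<mu> :: "mat2 measure"
  assumes haar: "haar_SL2 \<mu>"
begin

lemma haar_space: "space \<mu> = SL2"
  and haar_sets: "sets \<mu> = sets (restrict_space borel SL2)"
  and haar_left_invariant: "x \<in> SL2 \<Longrightarrow> A \<in> sets \<mu> \<Longrightarrow> emeasure \<mu> ((\<lambda>z. x ** z) ` A) = emeasure \<mu> A"
  and haar_compact_finite: "compact K \<Longrightarrow> K \<subseteq> SL2 \<Longrightarrow> emeasure \<mu> K < \<infinity>"
  and haar_nonzero: "emeasure \<mu> SL2 \<noteq> 0"
  using haar by (auto simp: haar_SL2_def)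

lemma haar_sets_iff: "A \<in> sets \<mu> \<longleftrightarrow> A \<in> sets borel \<and> A \<subseteq> SL2"
  using sets_restrict_space_iff[of SL2 borel A] by (auto simp: haar_sets)

lemma haar_measurable_ident: "(\<lambda>x. x) \<in> measurable \<mu> borel"
  by (subst measurable_cong_sets[OF haar_sets refl]) (rule measurable_restrict_space1, simp)

lemma haar_measurable_continuous:
  fixes h :: "mat2 \<Rightarrow> 'b::topological_space"
  assumes "continuous_on SL2 h"
  shows "h \<in> borel_measurable \<mu>"
  by (subst measurable_cong_sets[OF haar_sets refl]) (rule borel_measurable_continuous_on_restrict[OF assms])

lemma haar_measurable_Cc: "h \<in> Cc_SL2 \<Longrightarrow> h \<in> borel_measurable \<mu>"
  by (intro haar_measurable_continuous) (auto simp: Cc_SL2_def)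

lemma haar_measurable_translate:
  assumes "x \<in> SL2"
  shows "(\<lambda>z. x ** z) \<in> measurable \<mu> \<mu>"
proof -
  have "(\<lambda>z. x ** z) \<in> borel_measurable \<mu>"
    by (intro haar_measurable_continuous continuous_intros)
  then show ?thesis
    by (subst measurable_cong_sets[OF refl haar_sets], intro measurable_restrict_space2)
       (use assms in \<open>auto simp: haar_space SL2_mult\<close>)
qed

text \<open>Invariance is given for images, whereas \<open>distr\<close> uses preimages; the
  preimage under left translation by \<open>x\<close> is the image under translation by
  \<open>matrix_inv x\<close>.\<close>

lemma haar_distr_translate:
  assumes x: "x \<in> SL2"
  shows "distr \<mu> \<mu> (\<lambda>z. x ** z) = \<mu>"
proof (rule measure_eqI)
  fix A assume "A \<in> sets (distr \<mu> \<mu> (\<lambda>z. x ** z))"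
  then have A: "A \<in> sets \<mu>" by simp
  then have "A \<subseteq> SL2" by (simp add: haar_sets_iff)
  have "(\<lambda>z. x ** z) -` A \<inter> space \<mu> = (\<lambda>z. matrix_inv x ** z) ` A"
  proof (intro equalityI subsetI)
    fix z assume z: "z \<in> (\<lambda>z. x ** z) -` A \<inter> space \<mu>"
    then show "z \<in> (\<lambda>z. matrix_inv x ** z) ` A"
      using SL2_inv_cancel(2)[OF x, of z] by (intro image_eqI[of _ _ "x ** z"]) auto
  next
    fix z assume "z \<in> (\<lambda>z. matrix_inv x ** z) ` A"
    then show "z \<in> (\<lambda>z. x ** z) -` A \<inter> space \<mu>"
      using \<open>A \<subseteq> SL2\<close> x by (auto simp: SL2_inv_cancel SL2_mult SL2_inv haar_space)
  qed
  then show "emeasure (distr \<mu> \<mu> (\<lambda>z. x ** z)) A = emeasure \<mu> A"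
    using haar_left_invariant[OF SL2_inv[OF x] A]
    by (simp add: emeasure_distr[OF haar_measurable_translate[OF x] A])
qed simp

lemma haar_integral_translate:
  fixes F :: "mat2 \<Rightarrow> real"
  assumes "x \<in> SL2" "F \<in> borel_measurable \<mu>"
  shows "(\<integral>z. F (x ** z) \<partial>\<mu>) = (\<integral>z. F z \<partial>\<mu>)"
  using integral_distr[OF haar_measurable_translate[OF assms(1)] assms(2)]
  by (simp add: haar_distr_translate[OF assms(1)])

text \<open>By separability, countably many left translates of a nonempty open set cover the group.
  If one were null, all would be, and so would the group.\<close>

lemma haar_open_pos:
  assumes U: "open U" and x0: "x0 \<in> U \<inter> SL2"
  shows "emeasure \<mu> (U \<inter> SL2) \<noteq> 0"
proof
  assume null: "emeasure \<mu> (U \<inter> SL2) = 0"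
  have US: "U \<inter> SL2 \<in> sets \<mu>" using U by (auto simp: haar_sets_iff)
  obtain D where D: "countable D" "D \<subseteq> SL2" "SL2 \<subseteq> closure D" using separable[of SL2] by blast
  have tr: "(\<lambda>z. d ** z) ` (U \<inter> SL2) \<in> null_sets \<mu>" if "d \<in> D" for d
  proof
    have d: "d \<in> SL2" using that D by auto
    have "(\<lambda>z. d ** z) ` (U \<inter> SL2) = (\<lambda>z. matrix_inv d ** z) -` (U \<inter> SL2) \<inter> space \<mu>"
    proof (intro equalityI subsetI)
      fix z assume "z \<in> (\<lambda>z. matrix_inv d ** z) -` (U \<inter> SL2) \<inter> space \<mu>"
      then show "z \<in> (\<lambda>z. d ** z) ` (U \<inter> SL2)"
        using SL2_inv_cancel(1)[OF d, of z] by (intro image_eqI[of _ _ "matrix_inv d ** z"]) auto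
    qed (use d in \<open>auto simp: SL2_inv_cancel SL2_mult haar_space\<close>)
    then show "(\<lambda>z. d ** z) ` (U \<inter> SL2) \<in> sets \<mu>"
      using measurable_sets[OF haar_measurable_translate[OF SL2_inv[OF d]] US] by simp
    show "emeasure \<mu> ((\<lambda>z. d ** z) ` (U \<inter> SL2)) = 0"
      using haar_left_invariant[OF d US] null by simp
  qed
  have "SL2 \<subseteq> (\<Union>d\<in>D. (\<lambda>z. d ** z) ` (U \<inter> SL2))"
  proof
    fix z assume z: "z \<in> SL2"
    \<comment> \<open>The \<open>d\<close> with \<open>matrix_inv d ** z \<in> U\<close> form a neighbourhood of \<open>z ** matrix_inv x0\<close>.\<close>
    define y where "y = z ** matrix_inv x0"
    have y: "y \<in> SL2" using z x0 by (auto simp: y_def SL2_mult SL2_inv)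
    have cont: "continuous_on SL2 (\<lambda>d. matrix_inv d ** z)"
      by (intro continuous_intros) auto
    have "matrix_inv y ** z \<in> U"
      using x0 z by (simp add: y_def SL2_inv_mult SL2_inv SL2_inv_inv SL2_inv_cancel)
    then obtain W where W: "open W" "y \<in> W" "\<And>d. d \<in> SL2 \<Longrightarrow> d \<in> W \<Longrightarrow> matrix_inv d ** z \<in> U"
      using cont y U unfolding continuous_on_topological by meson
    have "y \<in> closure D" using y D by auto
    then have "W \<inter> D \<noteq> {}" using W(1,2) by (meson disjoint_iff open_Int_closure_eq_empty)
    then obtain d where d: "d \<in> D" "d \<in> W" by auto
    then have "d \<in> SL2" using D by auto
    then have "matrix_inv d ** z \<in> U \<inter> SL2" using W(3)[of d] d z by (auto simp: SL2_mult SL2_inv)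
    then show "z \<in> (\<Union>d\<in>D. (\<lambda>z. d ** z) ` (U \<inter> SL2))"
      using d \<open>d \<in> SL2\<close> by (auto intro!: bexI[of _ d] image_eqI[of _ _ "matrix_inv d ** z"] simp: SL2_inv_cancel)
  qed
  moreover have "(\<Union>d\<in>D. (\<lambda>z. d ** z) ` (U \<inter> SL2)) \<in> null_sets \<mu>"
    using D(1) tr by (rule null_sets_UN')
  ultimately have "SL2 \<in> null_sets \<mu>"
    by (meson haar_sets_iff SL2_borel null_sets_subset order_refl)
  then show False using haar_nonzero by auto
qed

section \<open>Integrals of compactly supported functions\<close>

lemma Cc_SL2_in_Lp:
  fixes h :: "mat2 \<Rightarrow> complex"
  assumes h: "h \<in> Cc_SL2" and p: "0 \<le> p"
  shows "h \<in> Lp_space p \<mu>"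
proof -
  obtain B where B: "\<And>z. z \<in> SL2 \<Longrightarrow> norm (h z) \<le> B" using Cc_SL2_bounded[OF h] by blast
  obtain K where K: "compact K" "K \<subseteq> SL2" "\<And>z. z \<in> SL2 - K \<Longrightarrow> h z = 0"
    using h by (auto simp: Cc_SL2_def)
  show ?thesis
    using haar_measurable_Cc[OF h] _ haar_compact_finite[OF K(1,2)] p
    by (rule Lp_space_bounded_support[where B=B])
       (use K B in \<open>auto simp: haar_sets_iff borel_compact haar_space indicator_def\<close>)
qed

lemma Cc_SL2_integrable:
  fixes h :: "mat2 \<Rightarrow> real"
  assumes h: "h \<in> Cc_SL2"
  shows "integrable \<mu> h"
  using Lp_space_integrable[OF Cc_SL2_in_Lp[OF Cc_SL2_of_real[OF h], of 1]] haar_measurable_Cc[OF h]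
  by (simp add: integrable_abs_iff)

text \<open>A zero integral would make \<open>w\<close> vanish almost everywhere, but
  \<open>w\<close> is positive on an open neighbourhood of \<open>x\<close>, which has positive
  measure. This permits division by the mass of a bump.\<close>

lemma Cc_SL2_integral_pos:
  fixes w :: "mat2 \<Rightarrow> real"
  assumes w: "w \<in> Cc_SL2" and nonneg: "\<And>z. z \<in> SL2 \<Longrightarrow> 0 \<le> w z" and x: "x \<in> SL2" "0 < w x"
  shows "0 < (\<integral>z. w z \<partial>\<mu>)"
proof -
  have int: "integrable \<mu> w" by (rule Cc_SL2_integrable[OF w])
  have nn: "AE z in \<mu>. 0 \<le> w z" using nonneg by (intro AE_I2) (simp add: haar_space)
  have "(\<integral>z. w z \<partial>\<mu>) \<noteq> 0"
  proof
    assume "(\<integral>z. w z \<partial>\<mu>) = 0"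
    then have ae: "AE z in \<mu>. w z = 0" using integral_nonneg_eq_0_iff_AE[OF int nn] by simp
    have "continuous_on SL2 w" using w by (auto simp: Cc_SL2_def)
    then obtain U where U: "open U" "x \<in> U" "\<And>z. z \<in> SL2 \<Longrightarrow> z \<in> U \<Longrightarrow> w z \<in> {0<..}"
      using x unfolding continuous_on_topological by (metis greaterThan_iff open_greaterThan)
    have "AE z in \<mu>. z \<notin> U \<inter> SL2" using ae by eventually_elim (use U(3) in fastforce)
    moreover have "U \<inter> SL2 \<in> sets \<mu>" using U by (auto simp: haar_sets_iff)
    ultimately have "emeasure \<mu> (U \<inter> SL2) = 0"
      by (subst (asm) AE_iff_measurable[of "U \<inter> SL2"]) (auto simp: haar_space)
    then show False using haar_open_pos[OF U(1)] x U(2) by auto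
  qed
  moreover have "0 \<le> (\<integral>z. w z \<partial>\<mu>)" using nn by (rule integral_nonneg_AE)
  ultimately show ?thesis by simp
qed

text \<open>An approximate-identity argument with two errors, each worth \<open>\<eta> / 2\<close>
  after division by \<open>c\<close>: replacing \<open>k\<close> by its average, and replacing the
  average by a Riemann sum.\<close>

lemma Cc_SL2_in_closed_subspace:
  fixes k :: "mat2 \<Rightarrow> real"
  assumes p: "0 < p" and V: "Lp_closed_subspace p \<mu> V" and x0: "x0 \<in> SL2"
    and bump: "\<And>\<delta>. 0 < \<delta> \<Longrightarrow> \<exists>w\<in>Cc_SL2. 0 < w x0 \<and> (\<forall>z\<in>SL2. 0 \<le> w z) \<and>
      (\<forall>z\<in>SL2. w z \<noteq> 0 \<longrightarrow> dist z x0 < \<delta>) \<and>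
      (\<forall>x\<in>SL2. (\<lambda>z. complex_of_real (w (matrix_inv x ** z ** x0))) \<in> V)"
    and k: "k \<in> Cc_SL2"
  shows "(\<lambda>z. complex_of_real (k z)) \<in> V"
proof -
  have kc: "continuous_on SL2 k" using k by (auto simp: Cc_SL2_def)
  obtain K where K: "compact K" "K \<subseteq> SL2" "\<And>z. z \<in> SL2 - K \<Longrightarrow> k z = 0"
    using k by (auto simp: Cc_SL2_def)
  obtain R where R: "0 < R" "\<And>z. z \<in> K \<Longrightarrow> norm z \<le> R"
    using compact_imp_bounded[OF K(1)] by (auto simp: bounded_pos)
  have kR: "norm z \<le> R" if "z \<in> SL2" "k z \<noteq> 0" for z using K(3)[of z] R(2)[of z] that by blast
  \<comment> \<open>Radius \<open>2 * R\<close> leaves room for the bump: when \<open>x\<close> and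
    \<open>z\<close> interact and one of them lies in the support of \<open>k\<close>, their
    distance is at most \<open>norm x / 2\<close>, so both have norm at most
    \<open>2 * R\<close>.\<close>
  define S where "S = SL2 \<inter> cball 0 (2 * R)"
  have S: "compact S" "S \<subseteq> SL2" unfolding S_def by (auto intro: closed_Int_compact closed_SL2)
  have SM: "S \<in> sets \<mu>" using S by (simp add: haar_sets_iff borel_compact)
  show ?thesis
  proof (rule Lp_closed_subspace_uniform_limit[OF p V _ SM haar_compact_finite[OF S]])
    show "(\<lambda>z. complex_of_real (k z)) \<in> borel_measurable \<mu>"
      by (rule haar_measurable_Cc[OF Cc_SL2_of_real[OF k]])
    show "complex_of_real (k z) = 0" if "z \<in> space \<mu> - S" for z
      using that kR[of z] R(1) by (cases "k z = 0") (auto simp: S_def haar_space)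
    fix \<eta> :: real assume \<eta>: "0 < \<eta>"
    define b where "b = norm (matrix_inv x0) + 1"
    have b: "0 < b" unfolding b_def by (intro add_nonneg_pos) auto
    have "uniformly_continuous_on S k"
      using compact_uniformly_continuous[OF continuous_on_subset[OF kc S(2)] S(1)] .
    then obtain \<tau> where \<tau>: "0 < \<tau>" "\<And>x z. x \<in> S \<Longrightarrow> z \<in> S \<Longrightarrow> dist z x < \<tau> \<Longrightarrow> dist (k z) (k x) < \<eta> / 2"
      using \<eta> unfolding uniformly_continuous_on_def by (metis half_gt_zero)
    \<comment> \<open>The first bound makes interacting points satisfy
      \<open>dist z x \<le> norm x / 2\<close>; the second makes their distance less than
      \<open>\<tau>\<close> once they lie in \<open>S\<close>.\<close>
    define \<delta> where "\<delta> = min (1 / (2 * b)) (\<tau> / (4 * R * b))"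
    have \<delta>: "0 < \<delta>" using b R \<tau> by (simp add: \<delta>_def)
    have \<delta>b: "\<delta> * b \<le> 1 / 2" "2 * R * (\<delta> * b) \<le> \<tau> / 2"
    proof -
      have "\<delta> \<le> 1 / (2 * b)" "\<delta> \<le> \<tau> / (4 * R * b)" by (auto simp: \<delta>_def)
      then show "\<delta> * b \<le> 1 / 2" "2 * R * (\<delta> * b) \<le> \<tau> / 2"
        using b R(1) by (simp_all add: field_simps)
    qed
    obtain w where w: "w \<in> Cc_SL2" "0 < w x0" and w0: "\<And>z. z \<in> SL2 \<Longrightarrow> 0 \<le> w z"
      and wd: "\<And>z. z \<in> SL2 \<Longrightarrow> w z \<noteq> 0 \<Longrightarrow> dist z x0 < \<delta>"
      and wV: "\<And>x. x \<in> SL2 \<Longrightarrow> (\<lambda>z. complex_of_real (w (matrix_inv x ** z ** x0))) \<in> V"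
      using bump[OF \<delta>] by blast
    define v where "v x z = w (matrix_inv x ** z ** x0)" for x z :: mat2
    have near: "dist z x \<le> norm x * (\<delta> * b)" if xz: "x \<in> SL2" "z \<in> SL2" "v x z \<noteq> 0" for x z
    proof -
      define d where "d = matrix_inv x ** z ** x0 - x0"
      have "norm d < \<delta>"
        using wd[of "matrix_inv x ** z ** x0"] xz x0 by (simp add: v_def SL2_mult SL2_inv d_def dist_norm)
      \<comment> \<open>Undoing both translations exhibits \<open>z - x\<close> as the small matrix
        \<open>d\<close> multiplied by \<open>x\<close> and \<open>matrix_inv x0\<close>. This is
        where the stretching factor \<open>norm x\<close> and the constant \<open>b\<close>
        arise.\<close>
      have "z - x = x ** (d ** matrix_inv x0)"
        using xz x0 by (simp add: d_def matrix_mult_diff_distrib matrix_mult_diff_rdistrib matrix_mul_assoc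
            SL2_inv_cancel SL2_inv_right)
      then have "norm (z - x) \<le> norm x * (norm d * norm (matrix_inv x0))"
        using order_trans[OF norm_matrix_mult_le mult_left_mono[OF norm_matrix_mult_le norm_ge_zero]] by simp
      also have "\<dots> \<le> norm x * (\<delta> * b)"
        using \<open>norm d < \<delta>\<close> \<delta> by (intro mult_left_mono mult_mono) (auto simp: b_def)
      finally show ?thesis by (simp add: dist_norm)
    qed
    have inS: "x \<in> S \<and> z \<in> S" if xz: "x \<in> SL2" "z \<in> SL2" "v x z \<noteq> 0" "k x \<noteq> 0 \<or> k z \<noteq> 0" for x z
    proof -
      have "dist z x \<le> norm x * (\<delta> * b)" using near xz by blast
      also have "\<dots> \<le> norm x * (1 / 2)" by (intro mult_left_mono \<delta>b) auto
      finally have d: "dist z x \<le> norm x / 2" by simp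
      moreover have "norm x \<le> norm z + dist z x" "norm z \<le> norm x + dist z x"
        by (simp_all add: dist_norm norm_triangle_sub norm_minus_commute[of z x])
          (metis norm_minus_commute norm_triangle_sub)
      ultimately have "norm x \<le> 2 * R" "norm z \<le> 2 * R"
        using kR[of x] kR[of z] xz R(1) by linarith+
      then show ?thesis using xz by (simp add: S_def)
    qed
    \<comment> \<open>The bound keeps the factor \<open>v x z\<close>, so integration over
      \<open>x\<close> yields exactly \<open>\<eta> / 2\<close> times the mass
      \<open>c\<close>.\<close>
    have close: "\<bar>(k z - k x) * v x z\<bar> \<le> \<eta> / 2 * v x z" if xz: "x \<in> SL2" "z \<in> SL2" for x z
    proof (cases "v x z = 0 \<or> (k x = 0 \<and> k z = 0)")
      case False
      then have xzS: "x \<in> S" "z \<in> S" using inS xz by blast+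
      have "dist z x \<le> norm x * (\<delta> * b)" using near xz False by blast
      also have "\<dots> \<le> 2 * R * (\<delta> * b)"
        using xzS \<delta> b by (intro mult_right_mono) (auto simp: S_def)
      finally have "dist z x < \<tau>" using \<delta>b \<tau>(1) by linarith
      then have "\<bar>k z - k x\<bar> \<le> \<eta> / 2"
        using \<tau>(2)[OF xzS] by (simp add: dist_real_def)
      moreover have "0 \<le> v x z" using w0 xz x0 by (simp add: v_def SL2_mult SL2_inv)
      ultimately have "\<bar>k z - k x\<bar> * \<bar>v x z\<bar> \<le> \<eta> / 2 * v x z"
        using \<eta> by (intro mult_mono) auto
      then show ?thesis by (simp only: abs_mult)
    qed (use w0 xz x0 \<eta> in \<open>auto simp: v_def SL2_mult SL2_inv\<close>)
    \<comment> \<open>As a function of \<open>x\<close>, \<open>v x z\<close> is the left translate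
      of the fixed \<open>F\<close> by \<open>z\<close>; hence its mass is the same for all
      \<open>z\<close>. Positivity of the mass comes from \<open>F (mat 1) = w x0\<close>.\<close>
    define F where "F y = w (matrix_inv y ** x0)" for y
    define c where "c = (\<integral>y. F y \<partial>\<mu>)"
    have FC: "F \<in> Cc_SL2"
      unfolding F_def by (rule Cc_SL2_inverse_translate[OF w(1) x0])
    have c: "0 < c" unfolding c_def
      using SL2_inv_unique[of "mat 1" "mat 1"] w0 w(2) x0
      by (intro Cc_SL2_integral_pos[OF FC _ SL2_mat_1]) (auto simp: F_def SL2_mult SL2_inv SL2_mat_1)
    have vF: "v x z = F (matrix_inv z ** x)" if "x \<in> SL2" "z \<in> SL2" for x z
      using that by (simp add: v_def F_def SL2_inv_mult SL2_inv SL2_inv_inv)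
    have vint: "(\<integral>x. v x z \<partial>\<mu>) = c" if z: "z \<in> SL2" for z
    proof -
      have "(\<integral>x. v x z \<partial>\<mu>) = (\<integral>x. F (matrix_inv z ** x) \<partial>\<mu>)"
        using z by (intro Bochner_Integration.integral_cong) (auto simp: vF haar_space)
      also have "\<dots> = c"
        unfolding c_def by (rule haar_integral_translate[OF SL2_inv[OF z] haar_measurable_Cc[OF FC]])
      finally show ?thesis .
    qed
    have vC: "(\<lambda>x. v x z) \<in> Cc_SL2" if z: "z \<in> SL2" for z
      using Cc_SL2_inverse_translate[OF w(1) SL2_mult[OF z x0]] by (simp add: v_def matrix_mul_assoc)
    have wc: "continuous_on SL2 w" using w(1) by (auto simp: Cc_SL2_def)
    have Hc: "continuous_on (S \<times> S) (\<lambda>(x, z). k x * v x z)"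
      unfolding v_def split_beta using S(2) x0
      by (intro continuous_intros continuous_on_compose2[OF kc] continuous_on_compose2[OF wc])
         (auto intro!: SL2_mult SL2_inv)
    \<comment> \<open>The tolerance contains \<open>c\<close> because the sum is later divided by
      \<open>c\<close>.\<close>
    obtain X m where X: "finite X" "X \<subseteq> S"
      and sum: "\<And>z. z \<in> S \<Longrightarrow> \<bar>(\<integral>x. indicator S x * (k x * v x z) \<partial>\<mu>) - (\<Sum>x\<in>X. m x * (k x * v x z))\<bar>
        \<le> c * \<eta> / 2"
      by (rule uniform_Riemann_sum[OF haar_measurable_ident S(1) _ haar_compact_finite[OF S] S(1) Hc,
            of "c * \<eta> / 2"]) (use c \<eta> S(2) in \<open>auto simp: haar_space\<close>)
    define r where "r z = (\<Sum>x\<in>X. m x * (k x * v x z))" for z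
    have rV: "(\<lambda>z. complex_of_real (r z / c)) \<in> V"
    proof -
      have "(\<lambda>z. \<Sum>x\<in>X. complex_of_real (m x * k x / c) * complex_of_real (v x z)) \<in> V"
        unfolding v_def using X(2) S(2) by (intro Lp_closed_subspace_sum[OF p V] wV) auto
      also have "(\<lambda>z. \<Sum>x\<in>X. complex_of_real (m x * k x / c) * complex_of_real (v x z))
          = (\<lambda>z. complex_of_real (r z / c))"
        by (simp add: r_def sum_divide_distrib mult.assoc)
      finally show ?thesis .
    qed
    have "\<bar>k z - r z / c\<bar> \<le> \<eta> * indicator S z" if z: "z \<in> SL2" for z
    proof (cases "z \<in> S")
      case False
      have "k x * v x z = 0" if "x \<in> X" for x
        using inS[of x z] False z that X(2) S(2) by auto
      then have "r z = 0" unfolding r_def by (intro sum.neutral) simp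
      moreover have "k z = 0" using kR[of z] False z R(1) by (cases "k z = 0") (auto simp: S_def)
      ultimately show ?thesis using \<eta> by simp
    next
      case True
      have iv: "integrable \<mu> (\<lambda>x. v x z)" by (rule Cc_SL2_integrable[OF vC[OF z]])
      have ikv: "integrable \<mu> (\<lambda>x. (k z - k x) * v x z)"
        by (rule Bochner_Integration.integrable_bound[OF integrable_mult_right[OF iv, of "\<eta> / 2"]])
           (use haar_measurable_Cc[OF k] haar_measurable_Cc[OF vC[OF z]] order_trans[OF close abs_ge_self] z
             in \<open>auto intro!: AE_I2 simp: haar_space\<close>)
      have ikv': "integrable \<mu> (\<lambda>x. k z * v x z)" using iv by simp
      \<comment> \<open>Restricting the integral to \<open>S\<close> loses nothing: a nonzero
        \<open>k x * v x z\<close> already forces \<open>x \<in> S\<close>.\<close>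
      have *: "indicator S x * (k x * v x z) = k x * v x z" if "x \<in> SL2" for x
        using inS[of x z] that z by (cases "k x * v x z = 0") auto
      have split: "(k z - k x) * v x z = k z * v x z - indicator S x * (k x * v x z)" if "x \<in> SL2" for x
        unfolding *[OF that] by (rule left_diff_distrib)
      have "(\<integral>x. (k z - k x) * v x z \<partial>\<mu>) = (\<integral>x. k z * v x z - indicator S x * (k x * v x z) \<partial>\<mu>)"
        by (intro Bochner_Integration.integral_cong) (auto simp: split haar_space)
      also have "\<dots> = c * k z - (\<integral>x. indicator S x * (k x * v x z) \<partial>\<mu>)"
      proof (subst Bochner_Integration.integral_diff[OF ikv'])
        have "integrable \<mu> (\<lambda>x. k z * v x z - (k z - k x) * v x z)"
          using ikv ikv' by (rule Bochner_Integration.integrable_diff[rotated])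
        then show "integrable \<mu> (\<lambda>x. indicator S x * (k x * v x z))"
          by (rule Bochner_Integration.integrable_cong[THEN iffD1, rotated 2])
             (auto simp: split haar_space)
      qed (simp add: vint[OF z])
      finally have eq: "c * k z - (\<integral>x. indicator S x * (k x * v x z) \<partial>\<mu>) = (\<integral>x. (k z - k x) * v x z \<partial>\<mu>)" ..
      have "\<bar>\<integral>x. (k z - k x) * v x z \<partial>\<mu>\<bar> \<le> (\<integral>x. \<eta> / 2 * v x z \<partial>\<mu>)"
        using ikv iv close z
        by (intro integral_abs_bound[THEN order_trans] integral_mono) (auto simp: haar_space)
      also have "\<dots> = c * \<eta> / 2" by (simp add: vint[OF z])
      finally have "\<bar>c * k z - r z\<bar> \<le> c * \<eta>"
        using sum[OF True] eq unfolding r_def by linarith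
      moreover have "k z - r z / c = (c * k z - r z) / c" using c by (simp add: field_simps)
      ultimately show ?thesis using True c by (simp add: abs_divide divide_le_eq mult.commute)
    qed
    then show "\<exists>h\<in>V. \<forall>z\<in>space \<mu>. norm (complex_of_real (k z) - h z) \<le> \<eta> * indicator S z"
      by (intro bexI[OF _ rV]) (simp add: haar_space del: of_real_divide flip: of_real_diff)
  qed
qed

text \<open>Continuous functions give indicators of compact sets as pointwise limits, and inner
  regularity then gives indicators of all sets of finite measure.\<close>

lemma Cc_SL2_dense:
  assumes p: "0 < p" and V: "Lp_closed_subspace p \<mu> V"
    and Cc: "\<And>k. k \<in> Cc_SL2 \<Longrightarrow> (\<lambda>z. complex_of_real (k z)) \<in> V"
  shows "V = Lp_space p \<mu>"
proof (rule Lp_closed_subspace_eq_Lp[OF p V])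
  have zero: "(\<lambda>z. 0) \<in> V" using V by (simp add: Lp_closed_subspace_def)
  have ind_compact: "(\<lambda>z. indicator C z) \<in> V" if C: "compact C" "C \<subseteq> SL2" for C
  \<comment> \<open>The empty set is separated because \<open>infdist z {}\<close> is
    \<open>0\<close>, so the functions below would be constantly \<open>1\<close> instead of tending
    to \<open>0\<close>.\<close>
  proof (cases "C = {}")
    case False
    \<comment> \<open>Tents that shrink to the indicator of \<open>C\<close>. Since
      \<open>Suc n \<ge> 1\<close>, all of them vanish outside the closed 1-neighbourhood
      \<open>K\<close>, whose indicator dominates them.\<close>
    define k where "k n z = max 0 (1 - real (Suc n) * infdist z C)" for n z
    define K where "K = SL2 \<inter> {z. infdist z C \<le> 1}"
    have K: "compact K" "K \<subseteq> SL2"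
      using compact_infdist_le[OF False C(1), of 1] closed_SL2 by (auto simp: K_def closed_Int_compact)
    have k0: "k n z = 0" if "z \<in> SL2 - K" for n z
    proof -
      have "1 * 1 \<le> real (Suc n) * infdist z C"
        using that by (intro mult_mono) (auto simp: K_def)
      then show ?thesis by (simp add: k_def)
    qed
    have kC: "k n \<in> Cc_SL2" for n
      unfolding Cc_SL2_def using K k0
      by (auto simp: k_def[abs_def] intro!: continuous_intros)
    have KM: "K \<in> sets \<mu>" and CM: "C \<in> sets \<mu>"
      using K C by (auto simp: haar_sets_iff borel_compact)
    have BL: "(\<lambda>z. indicator K z :: complex) \<in> Lp_space p \<mu>"
      by (rule Lp_space_bounded_support[where B=1, OF _ KM haar_compact_finite[OF K]])
         (use p KM in \<open>auto simp: indicator_def\<close>)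
    show ?thesis
    proof (rule Lp_closed_subspace_limit[OF p V Cc[OF kC] _ _ BL])
      fix z
      have "(\<lambda>n. k n z) \<longlonglongrightarrow> indicator C z"
      proof (cases "z \<in> C")
        case True
        then show ?thesis by (simp add: k_def)
      next
        case False
        then have "0 < infdist z C"
          using C(1) \<open>C \<noteq> {}\<close> by (metis compact_imp_closed in_closed_iff_infdist_zero infdist_nonneg less_le)
        then obtain N where N: "1 < real N * infdist z C" using reals_Archimedean3 by blast
        have "k n z = 0" if "n \<ge> N" for n
        proof -
          have "real N * infdist z C \<le> real (Suc n) * infdist z C"
            using that by (intro mult_right_mono infdist_nonneg) auto
          then show ?thesis using N by (simp add: k_def)
        qed
        then have "(\<lambda>n. k n z) \<longlonglongrightarrow> 0"
          by (intro tendsto_eventually eventually_sequentiallyI)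
        then show ?thesis using False by simp
      qed
      from tendsto_of_real[OF this, where 'a=complex]
      show "(\<lambda>n. complex_of_real (k n z)) \<longlonglongrightarrow> indicator C z"
        by (cases "z \<in> C") auto
    next
      fix n z assume "z \<in> space \<mu>"
      then show "norm (complex_of_real (k n z)) \<le> norm (indicator K z :: complex)"
        using k0[of z n] by (cases "z \<in> K") (auto simp: k_def haar_space infdist_nonneg)
    qed (use CM in measurable)
  qed (use zero in simp)
  fix A assume A: "A \<in> sets \<mu>" "emeasure \<mu> A < \<infinity>"
  have AS: "A \<in> sets borel" "A \<subseteq> SL2" using A(1) by (auto simp: haar_sets_iff)
  show "(\<lambda>z. indicator A z) \<in> V"
  proof (rule Lp_closed_subspace_closedI[OF p V])
    show "(\<lambda>z. indicator A z :: complex) \<in> Lp_space p \<mu>"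
      by (rule Lp_space_bounded_support[where B=1, OF _ A])
         (use p A in \<open>auto simp: indicator_def\<close>)
    fix \<epsilon> :: real assume \<epsilon>: "0 < \<epsilon>"
    \<comment> \<open>Inner regularity is applied to a finite Borel measure on the whole matrix
      space, so \<open>\<mu>\<close> is first cut down to \<open>A\<close> and pushed
      forward.\<close>
    define \<nu> where "\<nu> = distr (restrict_space \<mu> A) borel (\<lambda>x. x)"
    have id: "(\<lambda>x. x) \<in> measurable (restrict_space \<mu> A) borel"
      by (rule measurable_restrict_space1[OF haar_measurable_ident])
    have \<nu>: "emeasure \<nu> B = emeasure \<mu> (B \<inter> A)" if "B \<in> sets borel" for B
      using that A AS unfolding \<nu>_def
      by (subst emeasure_distr[OF id])
         (auto simp: space_restrict_space haar_space Int_absorb1 Int_absorb2 emeasure_restrict_space)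
    have \<nu>A: "emeasure \<nu> A = emeasure \<mu> A" using \<nu>[OF AS(1)] by simp
    have \<nu>fin: "emeasure \<nu> (space \<nu>) \<noteq> \<infinity>"
      using \<nu>[of UNIV] A by (simp add: \<nu>_def)
    have "\<exists>C\<in>{C. C \<subseteq> A \<and> compact C}. emeasure \<nu> A < emeasure \<nu> C + ennreal \<epsilon>"
    proof (rule ccontr)
      assume "\<not> ?thesis"
      then have "emeasure \<nu> C + ennreal \<epsilon> \<le> emeasure \<nu> A" if "C \<subseteq> A" "compact C" for C
        using that by (auto simp: not_less)
      then have "(SUP C\<in>{C. C \<subseteq> A \<and> compact C}. emeasure \<nu> C + ennreal \<epsilon>) \<le> emeasure \<nu> A"
        by (intro SUP_least) auto
      also have "(SUP C\<in>{C. C \<subseteq> A \<and> compact C}. emeasure \<nu> C + ennreal \<epsilon>)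
          = (SUP C\<in>{C. C \<subseteq> A \<and> compact C}. emeasure \<nu> C) + ennreal \<epsilon>"
        by (intro ennreal_SUP_add_left) auto
      also have "(SUP C\<in>{C. C \<subseteq> A \<and> compact C}. emeasure \<nu> C) = emeasure \<nu> A"
        by (rule inner_regular[OF _ \<nu>fin AS(1), symmetric]) (simp add: \<nu>_def)
      finally show False using \<nu>A A(2) \<epsilon> by (auto simp: ennreal_add_left_cancel_le less_top)
    qed
    then obtain C where C: "C \<subseteq> A" "compact C" "emeasure \<nu> A < emeasure \<nu> C + ennreal \<epsilon>" by blast
    have CM: "C \<in> sets \<mu>" using C AS by (auto simp: haar_sets_iff borel_compact)
    have Cfin: "emeasure \<mu> C < \<infinity>" using emeasure_mono[OF C(1) A(1)] A(2) by auto
    have "emeasure \<mu> A < emeasure \<mu> C + ennreal \<epsilon>"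
      using C \<nu>[of C] \<nu>A by (simp add: borel_compact Int_absorb2)
    then have "measure \<mu> A < measure \<mu> C + \<epsilon>"
      using A(2) Cfin \<epsilon> by (simp add: emeasure_eq_ennreal_measure less_top ennreal_less_iff flip: ennreal_plus)
    then have meas: "measure \<mu> (A - C) < \<epsilon>"
      using A CM C(1) by (subst measure_Diff) auto
    have "(\<integral>z. norm (indicator A z - indicator C z :: complex) powr p \<partial>\<mu>) = (\<integral>z. indicator (A - C) z \<partial>\<mu>)"
      using C(1) by (intro Bochner_Integration.integral_cong) (auto simp: indicator_def)
    also have "\<dots> < \<epsilon>" using meas AS(2) by (simp add: haar_space Int_absorb2 subset_trans[OF Diff_subset AS(2)])
    finally show "\<exists>h\<in>V. (\<integral>z. norm (indicator A z - h z) powr p \<partial>\<mu>) < \<epsilon>"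
      using ind_compact[of C] C AS by (intro bexI[of _ "\<lambda>z. indicator C z"]) auto
  qed
qed

end

section \<open>Translates of powers\<close>

text \<open>The linear span of the translates, as an inductive set to avoid handling index families.\<close>

inductive_set power_span :: "(mat2 \<Rightarrow> real) \<Rightarrow> (mat2 \<Rightarrow> complex) set" for f where
  zero: "(\<lambda>z. 0) \<in> power_span f"
| step: "h \<in> power_span f \<Longrightarrow> a \<in> SL2 \<Longrightarrow> b \<in> SL2 \<Longrightarrow> 1 \<le> m \<Longrightarrow>
    (\<lambda>z. h z + c * complex_of_real (ltrans a (rtrans b (\<lambda>w. f w ^ m)) z)) \<in> power_span f"

lemma power_span_add:
  assumes "g \<in> power_span f" "h \<in> power_span f"
  shows "(\<lambda>z. g z + h z) \<in> power_span f"
  using assms(2,1)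
proof (induction h rule: power_span.induct)
  case (step h a b m c)
  then show ?case using power_span.step[of "\<lambda>z. g z + h z" f a b m c] by (simp add: add.assoc)
qed simp

lemma power_span_cmult:
  assumes "h \<in> power_span f"
  shows "(\<lambda>z. c * h z) \<in> power_span f"
  using assms
proof (induction h rule: power_span.induct)
  case (step h a b m d)
  then show ?case using power_span.step[of "\<lambda>z. c * h z" f a b m "c * d"] by (simp add: algebra_simps)
qed (simp add: power_span.zero)

lemma power_span_translate:
  assumes "a \<in> SL2" "b \<in> SL2" "1 \<le> m"
  shows "(\<lambda>z. complex_of_real (ltrans a (rtrans b (\<lambda>w. f w ^ m)) z)) \<in> power_span f"
  using power_span.step[OF power_span.zero assms, where c=1] by simp

text \<open>Returns from the inductive description to an indexed finite sum; each step appends its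
  data at index \<open>N\<close>.\<close>

lemma power_spanE:
  assumes "h \<in> power_span f"
  obtains N :: nat and c a b m where "\<forall>i<N. a i \<in> SL2 \<and> b i \<in> SL2 \<and> 1 \<le> m i"
    and "h = (\<lambda>z. \<Sum>i<N. c i * complex_of_real (ltrans (a i) (rtrans (b i) (\<lambda>w. f w ^ m i)) z))"
proof -
  have "\<exists>(N::nat) c a b m. (\<forall>i<N. a i \<in> SL2 \<and> b i \<in> SL2 \<and> 1 \<le> m i) \<and>
      h = (\<lambda>z. \<Sum>i<N. c i * complex_of_real (ltrans (a i) (rtrans (b i) (\<lambda>w. f w ^ m i)) z))"
    using assms
  proof (induction h rule: power_span.induct)
    case zero
    show ?case by (rule exI[of _ 0]) simp
  next
    case (step h a b m c)
    then obtain N :: nat and c' a' b' m' where *: "\<forall>i<N. a' i \<in> SL2 \<and> b' i \<in> SL2 \<and> 1 \<le> m' i"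
      "h = (\<lambda>z. \<Sum>i<N. c' i * complex_of_real (ltrans (a' i) (rtrans (b' i) (\<lambda>w. f w ^ m' i)) z))"
      by blast
    show ?case
      by (rule exI[of _ "Suc N"], rule exI[of _ "c'(N := c)"], rule exI[of _ "a'(N := a)"],
          rule exI[of _ "b'(N := b)"], rule exI[of _ "m'(N := m)"])
         (use * step in \<open>auto simp: less_Suc_eq fun_eq_iff intro!: sum.cong\<close>)
  qed
  then show ?thesis using that by blast
qed

section \<open>From powers of \<open>f\<close> to continuous functions of \<open>f\<close>\<close>

lemma Cc_SL2_power: "f \<in> Cc_SL2 \<Longrightarrow> 1 \<le> m \<Longrightarrow> (\<lambda>z. (f z :: real) ^ m) \<in> Cc_SL2"
  by (rule Cc_SL2_map[of f "\<lambda>t. t ^ m"]) (auto intro!: continuous_intros)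

lemma power_span_subset_Lp:
  assumes haar: "haar_SL2 \<mu>" and p: "0 \<le> p" and f: "f \<in> Cc_SL2"
  shows "power_span f \<subseteq> Lp_space p \<mu>"
proof
  fix h assume "h \<in> power_span f"
  then show "h \<in> Lp_space p \<mu>"
  proof (induction h rule: power_span.induct)
    case zero
    show ?case by (simp add: Lp_space_def)
  next
    case (step h a b m c)
    have "(\<lambda>z. complex_of_real (ltrans a (rtrans b (\<lambda>w. f w ^ m)) z)) \<in> Lp_space p \<mu>"
      using Cc_SL2_translate[OF Cc_SL2_power[OF f] step.hyps(2,3)] step.hyps(4) p
      by (intro Cc_SL2_in_Lp[OF haar] Cc_SL2_of_real) (auto simp: ltrans_def rtrans_def)
    then show ?case using step.IH p by (intro Lp_space_add Lp_space_cmult)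
  qed
qed

text \<open>Only powers with positive exponent are available. The constant term of a Weierstrass
  approximant is its value at \<open>0\<close>, hence within \<open>e / 2\<close> of
  \<open>\<phi> 0 = 0\<close>, and dropping it costs another \<open>e / 2\<close>.\<close>

lemma uniform_approx_polynomial_vanishing_at_0:
  fixes \<phi> :: "real \<Rightarrow> real"
  assumes \<phi>: "continuous_on UNIV \<phi>" "\<phi> 0 = 0" and B: "0 \<le> B" and e: "0 < e"
  obtains a and n :: nat where "\<And>t. \<bar>t\<bar> \<le> B \<Longrightarrow> \<bar>\<phi> t - (\<Sum>i\<in>{1..n}. a i * t ^ i)\<bar> \<le> e"
proof -
  obtain q where q: "real_polynomial_function q" "\<And>t. t \<in> {-B..B} \<Longrightarrow> \<bar>\<phi> t - q t\<bar> < e / 2"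
    using Stone_Weierstrass_real_polynomial_function[of "{-B..B}" \<phi> "e / 2"] e
      continuous_on_subset[OF \<phi>(1)] by auto
  obtain a n where a: "q = (\<lambda>t. \<Sum>i\<le>n. a i * t ^ i)"
    using real_polynomial_function_imp_sum[OF q(1)] by blast
  have qa: "q t = a 0 + (\<Sum>i\<in>{1..n}. a i * t ^ i)" for t
  proof -
    have "{..n} = insert 0 {1..n}" by auto
    then show ?thesis by (simp add: a)
  qed
  have "\<bar>\<phi> t - (\<Sum>i\<in>{1..n}. a i * t ^ i)\<bar> \<le> e" if "\<bar>t\<bar> \<le> B" for t
  proof -
    have "q 0 = a 0" by (simp add: qa)
    then have "\<bar>a 0\<bar> < e / 2" using q(2)[of 0] B \<phi>(2) by simp
    moreover have "\<bar>\<phi> t - q t\<bar> < e / 2" using that by (intro q(2)) (auto simp: abs_le_iff)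
    ultimately show ?thesis using qa[of t] by linarith
  qed
  then show ?thesis using that by blast
qed

text \<open>The polynomial and \<open>\<phi>\<close> both vanish at \<open>0\<close>, so their
  compositions with the translate of \<open>f\<close> vanish off one compact set \<open>K\<close>,
  as the uniform limit criterion requires.\<close>

lemma Lp_closure_power_span_compose:
  assumes haar: "haar_SL2 \<mu>" and p: "0 < p" and V: "Lp_closed_subspace p \<mu> V"
    and sub: "power_span f \<subseteq> V" and f: "f \<in> Cc_SL2"
    and \<phi>: "continuous_on UNIV \<phi>" "\<phi> 0 = 0" and ab: "a \<in> SL2" "b \<in> SL2"
  shows "(\<lambda>z. complex_of_real (\<phi> (f (matrix_inv a ** z ** b)))) \<in> V"
proof -
  define g where "g z = f (matrix_inv a ** z ** b)" for z
  have g: "g \<in> Cc_SL2" unfolding g_def by (rule Cc_SL2_translate[OF f ab])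
  obtain B where B: "0 < B" "\<And>z. z \<in> SL2 \<Longrightarrow> norm (g z) \<le> B" using Cc_SL2_bounded[OF g] by blast
  obtain K where K: "compact K" "K \<subseteq> SL2" "\<And>z. z \<in> SL2 - K \<Longrightarrow> g z = 0"
    using g by (auto simp: Cc_SL2_def)
  have KM: "K \<in> sets \<mu>" using K by (simp add: haar_sets_iff[OF haar] borel_compact)
  have "(\<lambda>z. complex_of_real (\<phi> (g z))) \<in> V"
  proof (rule Lp_closed_subspace_uniform_limit[OF p V _ KM haar_compact_finite[OF haar K(1,2)]])
    show "(\<lambda>z. complex_of_real (\<phi> (g z))) \<in> borel_measurable \<mu>"
      by (intro haar_measurable_Cc[OF haar] Cc_SL2_of_real Cc_SL2_map[OF g \<phi>])
    show "complex_of_real (\<phi> (g z)) = 0" if "z \<in> space \<mu> - K" for z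
      using that K(3) \<phi>(2) by (simp add: haar_space[OF haar])
    fix \<eta> :: real assume "0 < \<eta>"
    then obtain c and n :: nat where cn: "\<And>t. \<bar>t\<bar> \<le> B \<Longrightarrow> \<bar>\<phi> t - (\<Sum>i\<in>{1..n}. c i * t ^ i)\<bar> \<le> \<eta>"
      using uniform_approx_polynomial_vanishing_at_0[OF \<phi>, of B \<eta>] B(1) by auto
    define h where "h z = (\<Sum>i\<in>{1..n}. complex_of_real (c i) * complex_of_real (g z ^ i))" for z
    have "h \<in> V"
      unfolding h_def[abs_def]
    proof (rule Lp_closed_subspace_sum[OF p V])
      fix i assume "i \<in> {1..n}"
      then show "(\<lambda>z. complex_of_real (g z ^ i)) \<in> V"
        using power_span_translate[OF ab, of i f] sub by (auto simp: ltrans_def rtrans_def g_def)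
    qed
    moreover have "norm (complex_of_real (\<phi> (g z)) - h z) \<le> \<eta> * indicator K z" if "z \<in> space \<mu>" for z
    proof (cases "z \<in> K")
      case True
      have "complex_of_real (\<phi> (g z)) - h z
          = complex_of_real (\<phi> (g z) - (\<Sum>i\<in>{1..n}. c i * g z ^ i))"
        by (simp add: h_def)
      then show ?thesis
        using cn[of "g z"] B(2)[of z] that True by (simp add: haar_space[OF haar] del: of_real_diff of_real_sum)
    next
      case False
      then have "g z = 0" using K(3) that by (simp add: haar_space[OF haar])
      then show ?thesis using False \<phi>(2) by (simp add: h_def power_0_left)
    qed
    ultimately show "\<exists>h\<in>V. \<forall>z\<in>space \<mu>. norm (complex_of_real (\<phi> (g z)) - h z) \<le> \<eta> * indicator K z"
      by blast
  qed
  then show ?thesis by (simp add: g_def)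
qed

text \<open>Since \<open>f\<close> vanishes somewhere away from \<open>x0\<close>, a strict extremum has a non-zero value.\<close>

lemma strict_extremum_separation:
  fixes f :: "mat2 \<Rightarrow> real"
  assumes f: "f \<in> Cc_SL2" and x0: "x0 \<in> SL2" and max: "\<And>z. z \<in> SL2 \<Longrightarrow> z \<noteq> x0 \<Longrightarrow> f z < f x0"
    and \<delta>: "0 < \<delta>"
  obtains s where "0 \<le> s" "s < f x0" "\<And>z. z \<in> SL2 \<Longrightarrow> \<delta> \<le> dist z x0 \<Longrightarrow> f z \<le> s"
proof -
  obtain K where fc: "continuous_on SL2 f" and K: "compact K" "K \<subseteq> SL2" "\<And>z. z \<in> SL2 - K \<Longrightarrow> f z = 0"
    using f by (auto simp: Cc_SL2_def)
  have "\<not> SL2 \<subseteq> insert x0 K"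
    using SL2_unbounded bounded_subset compact_imp_bounded[OF K(1)] by (metis bounded_insert)
  then obtain y where y: "y \<in> SL2" "y \<noteq> x0" "y \<notin> K" by blast
  then have pos: "0 < f x0" using max[of y] K(3)[of y] by simp
  \<comment> \<open>Away from the ball the compact part \<open>L\<close> attains its maximum,
    strictly below \<open>f x0\<close>; off \<open>K\<close> the value is \<open>0\<close>, also
    below \<open>f x0\<close>. Hence the threshold \<open>max s 0\<close>.\<close>
  define L where "L = K - ball x0 \<delta>"
  have L: "compact L" "L \<subseteq> SL2" using K by (auto simp: L_def compact_diff)
  have "\<exists>s. s < f x0 \<and> (\<forall>z\<in>L. f z \<le> s)"
  proof (cases "L = {}")
    case False
    then obtain w where w: "w \<in> L" "\<forall>z\<in>L. f z \<le> f w"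
      using continuous_attains_sup[OF L(1) False continuous_on_subset[OF fc L(2)]] by blast
    moreover have "w \<noteq> x0" using w(1) \<delta> by (auto simp: L_def)
    ultimately show ?thesis using max[of w] L(2) by auto
  qed (use pos in auto)
  then obtain s where s: "s < f x0" "\<And>z. z \<in> L \<Longrightarrow> f z \<le> s" by blast
  have "f z \<le> max s 0" if "z \<in> SL2" "\<delta> \<le> dist z x0" for z
    using s(2)[of z] K(3)[of z] that by (cases "z \<in> K") (auto simp: L_def dist_commute)
  then show ?thesis using that[of "max s 0"] s(1) pos by auto
qed

lemma strict_extremum_bump:
  fixes f :: "mat2 \<Rightarrow> real"
  assumes f: "f \<in> Cc_SL2" and x0: "x0 \<in> SL2" and \<delta>: "0 < \<delta>"
    and uniq: "(\<forall>z\<in>SL2. z \<noteq> x0 \<longrightarrow> f z < f x0) \<or> (\<forall>z\<in>SL2. z \<noteq> x0 \<longrightarrow> f x0 < f z)"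
  obtains \<phi> :: "real \<Rightarrow> real" where "continuous_on UNIV \<phi>" "\<phi> 0 = 0" "\<And>t. 0 \<le> \<phi> t" "0 < \<phi> (f x0)"
    "\<And>z. z \<in> SL2 \<Longrightarrow> \<phi> (f z) \<noteq> 0 \<Longrightarrow> dist z x0 < \<delta>"
proof -
  \<comment> \<open>The sign \<open>\<sigma>\<close> turns a minimum into a maximum.\<close>
  obtain \<sigma> :: real where "\<sigma> \<in> {1, -1}" and max: "\<And>z. z \<in> SL2 \<Longrightarrow> z \<noteq> x0 \<Longrightarrow> \<sigma> * f z < \<sigma> * f x0"
    using uniq by (metis insert_iff minus_mult_minus mult_minus1 mult_1 neg_less_iff_less)
  have "(\<lambda>z. \<sigma> * f z) \<in> Cc_SL2"
    by (rule Cc_SL2_map[OF f, of "\<lambda>t. \<sigma> * t"]) (auto intro!: continuous_intros)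
  then obtain s where s: "0 \<le> s" "s < \<sigma> * f x0"
      "\<And>z. z \<in> SL2 \<Longrightarrow> \<delta> \<le> dist z x0 \<Longrightarrow> \<sigma> * f z \<le> s"
    using strict_extremum_separation[of "\<lambda>z. \<sigma> * f z" x0 \<delta>] x0 max \<delta> by blast
  show ?thesis
  \<comment> \<open>Cutting off at height \<open>s\<close>: \<open>0 \<le> s\<close> gives the value
    \<open>0\<close> at \<open>0\<close>, and \<open>s < \<sigma> * f x0\<close> makes the function
    positive at \<open>f x0\<close>.\<close>
  proof (rule that[of "\<lambda>t. max 0 (\<sigma> * t - s)"])
    show "continuous_on UNIV (\<lambda>t. max 0 (\<sigma> * t - s))" by (intro continuous_intros)
    fix z assume "z \<in> SL2" "max 0 (\<sigma> * f z - s) \<noteq> 0"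
    then show "dist z x0 < \<delta>" using s(3)[of z] by (cases "dist z x0 < \<delta>") auto
  qed (use s in auto)
qed

theorem theorem2p4:
  fixes \<mu> :: "mat2 measure" and f :: "mat2 \<Rightarrow> real" and x0 :: mat2 and p :: real
  assumes haar: "haar_SL2 \<mu>"
    and fCc: "f \<in> Cc_SL2"
    and x0: "x0 \<in> SL2"
    and uniq: "(\<forall>z\<in>SL2. z \<noteq> x0 \<longrightarrow> f z < f x0) \<or> (\<forall>z\<in>SL2. z \<noteq> x0 \<longrightarrow> f x0 < f z)"
    and p: "1 \<le> p" "p < 2"
  shows "\<forall>g :: mat2 \<Rightarrow> complex. g \<in> borel_measurable \<mu> \<and> integrable \<mu> (\<lambda>z. norm (g z) powr p) \<longrightarrow>
     (\<forall>\<epsilon>>0. \<exists>(N::nat) (c::nat \<Rightarrow> complex) (a::nat \<Rightarrow> mat2) (b::nat \<Rightarrow> mat2) (m::nat \<Rightarrow> nat).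
        (\<forall>i<N. a i \<in> SL2 \<and> b i \<in> SL2 \<and> 1 \<le> m i) \<and>
        (let h = (\<lambda>z. \<Sum>i<N. c i * complex_of_real (ltrans (a i) (rtrans (b i) (\<lambda>w. f w ^ m i)) z))
         in integrable \<mu> (\<lambda>z. norm (g z - h z) powr p) \<and>
            (\<integral>z. norm (g z - h z) powr p \<partial>\<mu>) < \<epsilon>))"
proof (intro allI impI)
  fix g :: "mat2 \<Rightarrow> complex" and \<epsilon> :: real
  assume g: "g \<in> borel_measurable \<mu> \<and> integrable \<mu> (\<lambda>z. norm (g z) powr p)" and \<epsilon>: "0 < \<epsilon>"
  have p0: "0 \<le> p" "0 < p" using p by auto
  define V where "V = Lp_closure p \<mu> (power_span f)"
  have sub: "power_span f \<subseteq> Lp_space p \<mu>" by (rule power_span_subset_Lp[OF haar p0(1) fCc])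
  have V: "Lp_closed_subspace p \<mu> V"
    unfolding V_def
    by (rule Lp_closed_subspace_closure[OF p0(1) sub power_span.zero power_span_add power_span_cmult])
  have subV: "power_span f \<subseteq> V" unfolding V_def by (rule subset_Lp_closure[OF sub])
  have bump: "\<exists>w\<in>Cc_SL2. 0 < w x0 \<and> (\<forall>z\<in>SL2. 0 \<le> w z) \<and> (\<forall>z\<in>SL2. w z \<noteq> 0 \<longrightarrow> dist z x0 < \<delta>) \<and>
      (\<forall>x\<in>SL2. (\<lambda>z. complex_of_real (w (matrix_inv x ** z ** x0))) \<in> V)" if \<delta>: "0 < \<delta>" for \<delta>
  proof -
    obtain \<phi> :: "real \<Rightarrow> real" where \<phi>: "continuous_on UNIV \<phi>" "\<phi> 0 = 0" "\<And>t. 0 \<le> \<phi> t" "0 < \<phi> (f x0)"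
      "\<And>z. z \<in> SL2 \<Longrightarrow> \<phi> (f z) \<noteq> 0 \<Longrightarrow> dist z x0 < \<delta>"
      by (rule strict_extremum_bump[OF fCc x0 \<delta> uniq]) blast
    show ?thesis
    proof (rule bexI[OF _ Cc_SL2_map[OF fCc \<phi>(1,2)]], intro conjI ballI impI)
      fix x assume "x \<in> SL2"
      then show "(\<lambda>z. complex_of_real (\<phi> (f (matrix_inv x ** z ** x0)))) \<in> V"
        by (rule Lp_closure_power_span_compose[OF haar p0(2) V subV fCc \<phi>(1,2) _ x0])
    qed (use \<phi> in auto)
  qed
  have "V = Lp_space p \<mu>"
    by (rule Cc_SL2_dense[OF haar p0(2) V Cc_SL2_in_closed_subspace[OF haar p0(2) V x0 bump]])
  then have "g \<in> Lp_closure p \<mu> (power_span f)" using g by (simp add: V_def Lp_space_def)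
  then obtain h where h: "h \<in> power_span f" "(\<integral>z. norm (g z - h z) powr p \<partial>\<mu>) < \<epsilon>"
    using Lp_closureD \<epsilon> by blast
  \<comment> \<open>Integrability of the error is shown separately, since a small Bochner integral
    alone could be the default value \<open>0\<close> of a non-integrable function.\<close>
  have "(\<lambda>z. g z - h z) \<in> Lp_space p \<mu>"
    using g h(1) sub p0 by (intro Lp_space_diff) (auto simp: Lp_space_def)
  then have int: "integrable \<mu> (\<lambda>z. norm (g z - h z) powr p)" by (rule Lp_space_integrable)
  obtain N :: nat and c a b m where *: "\<forall>i<N. a i \<in> SL2 \<and> b i \<in> SL2 \<and> 1 \<le> m i"
    "h = (\<lambda>z. \<Sum>i<N. c i * complex_of_real (ltrans (a i) (rtrans (b i) (\<lambda>w. f w ^ m i)) z))"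
    using power_spanE[OF h(1)] .
  show "\<exists>(N::nat) (c::nat \<Rightarrow> complex) (a::nat \<Rightarrow> mat2) (b::nat \<Rightarrow> mat2) (m::nat \<Rightarrow> nat).
        (\<forall>i<N. a i \<in> SL2 \<and> b i \<in> SL2 \<and> 1 \<le> m i) \<and>
        (let h = (\<lambda>z. \<Sum>i<N. c i * complex_of_real (ltrans (a i) (rtrans (b i) (\<lambda>w. f w ^ m i)) z))
         in integrable \<mu> (\<lambda>z. norm (g z - h z) powr p) \<and>
            (\<integral>z. norm (g z - h z) powr p \<partial>\<mu>) < \<epsilon>)"
    using * h(2) int unfolding Let_def by blast
qed

end
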